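(* Let $d\ge1$ and $n\ge1$ be integers. Let $w_0\in L^1(\mathbb{R}^d,d\mu)$ be nonnegative and bounded, such that $\int_{\mathbb{R}^d}w_0\,d\mu=1$ and $$\int_{\mathbb{R}^d}w_0\,H_k\,d\mu=0\quad\text{for every }k\in\mathbb{N}^d\text{ such that }0<|k|<n.$$ Let $w$ be the solution of the Ornstein-Uhlenbeck equation $$\frac{\partial w}{\partial t}=\Delta w-x\cdot\nabla w,\qquad t>0,\ x\in\mathbb{R}^d,$$ with initial data $w(0,\cdot)=w_0$. Then $$\mathcal{E}_1[w(t,\cdot)]\le\mathcal{E}_1[w_0]\,e^{-n\,t/\mathcal{H}_1[w_0]}\quad\text{for all }t\ge0.$$
   Context: $\mathbb{N}=\{0,1,2,\dots\}$. $d\mu:=v_\infty\,dx$ is the Gaussian probability measure on $\mathbb{R}^d$, with $v_\infty(x):=(2\pi)^{-d/2}e^{-|x|^2/2}$. For $k=(k_1,\dots,k_d)\in\mathbb{N}^d$, $|k|:=\sum_{j=1}^dk_j$ and $H_k(x):=\prod_{j=1}^dh_{k_j}(x_j)$, where for $m\in\mathbb{N}$ and $y\in\mathbb{R}$, $h_m(y):=(-1)^m(m!)^{-1/2}e^{y^2/2}\frac{d^m}{dy^m}\big(e^{-y^2/2}\big)$ (normalized Hermite polynomials). The entropy is $\mathcal{E}_1[w]:=\int_{\mathbb{R}^d}w\log w\,d\mu$ (with $0\log0=0$). Define the auxiliary function $\mathsf{h}_1:[0,\infty)\to\mathbb{R}$ (denoted $h_1$ in the paper, not to be confused with the Hermite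 polynomial) by $\mathsf{h}_1(0)=1$, $\mathsf{h}_1(1)=\frac12$ and $\mathsf{h}_1(s):=\frac{s\log s-(s-1)}{|s-1|^2}$ for $s\in(0,1)\cup(1,\infty)$; it is continuous, nonnegative and decreasing. For nonnegative $w\in L^\infty(\mathbb{R}^d)$, $$\mathcal{H}_1[w]:=\|w\|_{L^\infty(\mathbb{R}^d)}\,\sup_{x\in\mathbb{R}^d}\mathsf{h}_1(w(x))=\|w\|_{L^\infty(\mathbb{R}^d)}\,\mathsf{h}_1\Big(\inf_{x\in\mathbb{R}^d}w(x)\Big),$$ where sup and inf are essential. The solution of the Ornstein-Uhlenbeck equation with initial data $w_0$ is the one associated with the heat kernel: with $u_0:=w_0v_\infty$ and $u(t,x)=\int_{\mathbb{R}^d}u_0(y)\,(4\pi t)^{-d/2}e^{-|x-y|^2/(4t)}\,dy$ (the solution of $\partial_tu=\Delta u$ with initial data $u_0$), $w=v/v_\infty$ where $v$ is determined by $u(t,x)=R^{-d}\,v(\log R,x/R)$, $R=R(t)=\sqrt{1+2t}$. *)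

theory Defs
  imports "HOL-Probability.Essential_Supremum"
begin

definition gauss_density :: "real ^ 'd \<Rightarrow> real" where
  "gauss_density x = (2 * pi) powr (- real CARD('d) / 2) * exp (- (norm x)\<^sup>2 / 2)"

definition gauss_measure :: "(real ^ 'd) measure" where
  "gauss_measure = density lborel (\<lambda>x. ennreal (gauss_density x))"

definition hermite :: "nat \<Rightarrow> real \<Rightarrow> real" where
  "hermite m y = (-1) ^ m / sqrt (fact m) * exp (y\<^sup>2 / 2)
     * (deriv ^^ m) (\<lambda>z. exp (- z\<^sup>2 / 2)) y"

definition multi_hermite :: "('d \<Rightarrow> nat) \<Rightarrow> real ^ 'd \<Rightarrow> real" where
  "multi_hermite k x = (\<Prod>j\<in>UNIV. hermite (k j) (x $ j))"

text \<open>The convention \<open>0 log 0 = 0\<close> holds because \<open>0 * ln 0 = 0\<close>.\<close>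

definition entropy1 :: "(real ^ 'd \<Rightarrow> real) \<Rightarrow> real" where
  "entropy1 w = (\<integral>x. w x * ln (w x) \<partial>gauss_measure)"

text \<open>Only the values at \<open>s \<ge> 0\<close> are meaningful.\<close>

definition aux_h1 :: "real \<Rightarrow> real" where
  "aux_h1 s = (if s = 0 then 1 else if s = 1 then 1/2
     else (s * ln s - (s - 1)) / \<bar>s - 1\<bar>\<^sup>2)"

text \<open>
  Essential suprema are taken with respect to Lebesgue measure, in the extended reals (the
  codomain of \<^const>\<open>esssup\<close> has to be a complete linear order), and then converted to
  reals.  Both are finite if \<open>w\<close> is measurable, nonnegative a.e. and essentially bounded,
  since \<open>aux_h1\<close> takes values in \<open>[0, 1]\<close> on \<open>[0, \<infinity>)\<close>.
\<close>

definition Linf_norm :: "(real ^ 'd \<Rightarrow> real) \<Rightarrow> real" where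
  "Linf_norm w = real_of_ereal (esssup lborel (\<lambda>x. ereal \<bar>w x\<bar>))"

definition cal_H1 :: "(real ^ 'd \<Rightarrow> real) \<Rightarrow> real" where
  "cal_H1 w = Linf_norm w * real_of_ereal (esssup lborel (\<lambda>x. ereal (aux_h1 (w x))))"

text \<open>
  The heat-kernel solution of \<open>u\<^sub>t = \<Delta>u\<close>.  The kernel degenerates at \<open>t = 0\<close>, where the
  solution is the initial datum.
\<close>

definition heat_solution :: "(real ^ 'd \<Rightarrow> real) \<Rightarrow> real \<Rightarrow> real ^ 'd \<Rightarrow> real" where
  "heat_solution u0 t x = (if t = 0 then u0 x else
     (\<integral>y. u0 y * ((4 * pi * t) powr (- real CARD('d) / 2)
        * exp (- (norm (x - y))\<^sup>2 / (4 * t))) \<partial>lborel))"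

definition scale_R :: "real \<Rightarrow> real" where
  "scale_R t = sqrt (1 + 2 * t)"

text \<open>
  \<open>w\<close> is the solution of \<open>w\<^sub>t = \<Delta>w - x \<bullet> \<nabla>w\<close> with initial datum \<open>w0\<close> that is associated
  with the heat kernel through the self-similar change of variables: starting from
  \<open>u0 = w0 * gauss_density\<close>, the heat solution \<open>u\<close> determines \<open>v\<close> on \<open>[0, \<infinity>)\<close> (as \<open>ln (scale_R t)\<close>
  ranges over \<open>[0, \<infinity>)\<close>), and \<open>w = v / gauss_density\<close>.
\<close>

definition OU_solution ::
  "(real ^ 'd \<Rightarrow> real) \<Rightarrow> (real \<Rightarrow> real ^ 'd \<Rightarrow> real) \<Rightarrow> bool" where
  "OU_solution w0 w \<longleftrightarrow> (\<exists>v.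
     (\<forall>t\<ge>0. \<forall>x. heat_solution (\<lambda>y. w0 y * gauss_density y) t x =
        1 / scale_R t ^ CARD('d) * v (ln (scale_R t)) ((1 / scale_R t) *\<^sub>R x)) \<and>
     (\<forall>t\<ge>0. \<forall>x. w t x = v t x / gauss_density x))"

lemma scale_R_pos: "t \<ge> 0 \<Longrightarrow> scale_R t > 0"
  by (simp add: scale_R_def)

lemma scale_R_inverse: "scale_R ((exp (2 * t) - 1) / 2) = exp t"
proof -
  have "1 + 2 * ((exp (2 * t) - 1) / 2) = (exp t)\<^sup>2"
    unfolding exp_double by (simp add: field_simps)
  then show ?thesis by (simp add: scale_R_def)
qed

lemma OU_solution_iff:
  fixes w0 :: "real ^ 'd \<Rightarrow> real"
  shows "OU_solution w0 w \<longleftrightarrow> (\<forall>t\<ge>0. \<forall>x. w t x =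
    exp t ^ CARD('d) * heat_solution (\<lambda>y. w0 y * gauss_density y)
      ((exp (2 * t) - 1) / 2) (exp t *\<^sub>R x) / gauss_density x)"
    (is "_ \<longleftrightarrow> (\<forall>t\<ge>0. \<forall>x. w t x = ?v t x / gauss_density x)")
proof
  assume "OU_solution w0 w"
  then obtain v where
    v: "\<And>t x. t \<ge> 0 \<Longrightarrow> heat_solution (\<lambda>y. w0 y * gauss_density y) t x =
        1 / scale_R t ^ CARD('d) * v (ln (scale_R t)) ((1 / scale_R t) *\<^sub>R x)"
    and w: "\<And>t x. t \<ge> 0 \<Longrightarrow> w t x = v t x / gauss_density x"
    unfolding OU_solution_def by blast
  have "?v t x = v t x" if "t \<ge> 0" for t x
  proof -
    have "(exp (2 * t) - 1) / 2 \<ge> 0" using that by simp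
    from v[OF this, of "exp t *\<^sub>R x"] show ?thesis
      by (simp add: scale_R_inverse)
  qed
  with w show "\<forall>t\<ge>0. \<forall>x. w t x = ?v t x / gauss_density x" by simp
next
  assume w: "\<forall>t\<ge>0. \<forall>x. w t x = ?v t x / gauss_density x"
  have "heat_solution (\<lambda>y. w0 y * gauss_density y) t x =
        1 / scale_R t ^ CARD('d) * ?v (ln (scale_R t)) ((1 / scale_R t) *\<^sub>R x)"
    if "t \<ge> 0" for t x
  proof -
    have p: "scale_R t > 0" using that by (rule scale_R_pos)
    then have "exp (2 * ln (scale_R t)) = (scale_R t)\<^sup>2"
      unfolding exp_double by simp
    then have "(exp (2 * ln (scale_R t)) - 1) / 2 = t"
      using that by (simp add: scale_R_def)
    then show ?thesis using p by simp
  qed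
  with w show "OU_solution w0 w"
    unfolding OU_solution_def by (intro exI[of _ ?v]) blast
qed

lemma OU_solution_initial: "OU_solution w0 w \<Longrightarrow> w 0 = w0"
  by (rule ext) (simp add: OU_solution_iff heat_solution_def gauss_density_def)

end

theory Submission
  imports Defs "HOL-Probability.Distributions" "HOL-Real_Asymp.Real_Asymp"
begin

text \<open>
  In Ornstein-Uhlenbeck variables the solution is \<open>P\<^sub>r w\<^sub>0\<close> with \<open>r = e\<^sup>-\<^sup>t\<close>, where \<open>P\<^sub>r\<close>
  integrates against the Mehler kernel; \<open>P\<^sub>r P\<^sub>s = P\<^sub>r\<^sub>s\<close> and \<open>P\<^sub>r\<close> is self-adjoint and
  preserves constants.  The entropy dissipation is treated in discrete time, so that nothing has
  to be differentiated in \<open>t\<close> or \<open>x\<close>.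

  Let \<open>M\<close> be the essential supremum of \<open>w\<close> and \<open>K\<close> that of \<open>aux_h1 (w x)\<close>.  The function
  \<open>s ln s - s\<^sup>2 / (2 M)\<close> is convex on \<open>[0, M]\<close>, so Jensen's inequality and the invariance of the
  Gaussian measure bound the entropy loss from \<open>w\<close> to \<open>P\<^sub>r w\<close> below by
  \<open>(\<parallel>w - 1\<parallel>\<^sup>2 - \<parallel>P\<^sub>r (w - 1)\<parallel>\<^sup>2) / (2 M)\<close>.  With \<open>\<parallel>P\<^sub>r (w - 1)\<parallel>\<^sup>2 \<le> r\<^sup>2\<^sup>n \<parallel>w - 1\<parallel>\<^sup>2\<close> and
  \<open>entropy1 w \<le> K \<parallel>w - 1\<parallel>\<^sup>2\<close> one step contracts the entropy by
  \<open>exp (- (1 - r\<^sup>2\<^sup>n) / (2 M K))\<close>; \<open>m\<close> steps with \<open>r = exp (- t / m)\<close> and \<open>m \<rightarrow> \<infinity>\<close> give the rate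
  \<open>n / (M K)\<close>.  Neither \<open>M\<close> nor \<open>K\<close> grows along the flow, the latter because \<open>aux_h1\<close> is
  decreasing.

  The contraction needs no completeness of the Hermite polynomials.  By self-adjointness the
  sequence \<open>j \<mapsto> \<parallel>P\<^sub>r\<^sup>j f\<parallel>\<^sup>2\<close> is log-convex, so an asymptotic bound \<open>O(r\<^sup>2\<^sup>n\<^sup>j)\<close> already forces
  each step to contract by \<open>r\<^sup>2\<^sup>n\<close>; the asymptotic bound follows from the Taylor expansion of the
  Mehler kernel at \<open>r = 0\<close>, whose low order terms are orthogonal to \<open>f\<close>.
\<close>

subsection \<open>Gaussian integrals\<close>

lemma lborel_integral_prod_vec:
  fixes g :: "'d::finite \<Rightarrow> real \<Rightarrow> real"
  assumes g: "\<And>j. integrable lborel (g j)"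
  shows "has_bochner_integral lborel (\<lambda>x::real^'d. \<Prod>j\<in>UNIV. g j (x $ j))
    (\<Prod>j\<in>UNIV. integral\<^sup>L lborel (g j))"
proof -
  interpret product_sigma_finite "\<lambda>_ :: real^'d. lborel :: real measure" by standard
  define e :: "'d \<Rightarrow> real^'d" where "e = (\<lambda>j. axis j 1)"
  have inj: "inj e" by (auto simp: inj_def e_def axis_eq_axis)
  have B: "Basis = range e" by (auto simp: Basis_vec_def e_def)
  define h where "h b = g (inv e b)" for b
  have he: "h (e j) = g j" for j by (simp add: h_def inj)
  have h: "integrable lborel (h b)" for b by (simp add: h_def g)
  have gm[measurable]: "g j \<in> borel_measurable borel" for j using g[of j] by simp
  have eq: "(\<Prod>j\<in>UNIV. g j (x $ j)) = (\<Prod>b\<in>Basis. h b (x \<bullet> b))" for x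
  proof -
    have "(\<Prod>b\<in>Basis. h b (x \<bullet> b)) = (\<Prod>j\<in>UNIV. h (e j) (x \<bullet> e j))"
      by (simp add: B prod.reindex[OF inj])
    moreover have "x \<bullet> e j = x $ j" for j by (simp add: e_def inner_axis)
    ultimately show ?thesis by (simp add: he)
  qed
  have pe: "(\<Prod>b\<in>Basis. h b ((\<Sum>c\<in>Basis. f c *\<^sub>R c) \<bullet> b)) = (\<Prod>b\<in>Basis. h b (f b))" for f
    by (intro prod.cong) (auto simp: inner_sum_left_Basis)
  have m: "(\<lambda>x::real^'d. \<Prod>j\<in>UNIV. g j (x $ j)) \<in> borel_measurable borel" by measurable
  have m': "(\<lambda>f. \<Sum>b\<in>Basis. f b *\<^sub>R b) \<in> measurable (\<Pi>\<^sub>M b\<in>(Basis::(real^'d) set). lborel) borel"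
    by measurable
  have i: "integrable (\<Pi>\<^sub>M b\<in>Basis. lborel) (\<lambda>f. \<Prod>b\<in>Basis. h b (f b))"
    by (rule product_integrable_prod) (auto simp: h)
  have "integrable lborel (\<lambda>x::real^'d. \<Prod>j\<in>UNIV. g j (x $ j))"
    by (subst lborel_eq, subst integrable_distr_eq[OF m' m]) (simp only: eq pe i)
  moreover have "(\<integral>x. (\<Prod>j\<in>UNIV. g j (x $ j)) \<partial>(lborel::(real^'d) measure)) = (\<Prod>b\<in>Basis. integral\<^sup>L lborel (h b))"
    by (subst lborel_eq, subst integral_distr[OF m' m])
      (simp only: eq pe product_integral_prod h finite_Basis)
  ultimately show ?thesis
    by (simp add: has_bochner_integral_iff B prod.reindex[OF inj] he)
qed

text \<open>Completing the square turns the integrand into a multiple of the normal density with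
  mean \<open>b / c\<close> and variance \<open>1 / c\<close>.\<close>

lemma gaussian_integral_1:
  fixes b c :: real
  assumes c: "c > 0"
  shows "has_bochner_integral lborel (\<lambda>z. exp (b * z - c * z\<^sup>2 / 2))
    (sqrt (2 * pi / c) * exp (b\<^sup>2 / (2 * c)))"
proof -
  define s where "s = 1 / sqrt c"
  have s: "s > 0" "s\<^sup>2 = 1 / c" using c by (auto simp: s_def power_divide)
  have eq: "exp (b * z - c * z\<^sup>2 / 2) =
      (sqrt (2 * pi / c) * exp (b\<^sup>2 / (2 * c))) * normal_density (b / c) s z" for z
  proof -
    have "b * z - c * z\<^sup>2 / 2 = b\<^sup>2 / (2 * c) + (- (z - b / c)\<^sup>2 / (2 * s\<^sup>2))"
      unfolding s(2) using c by (simp add: power2_eq_square field_simps)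
    then have "exp (b * z - c * z\<^sup>2 / 2) = exp (b\<^sup>2 / (2 * c)) * exp (- (z - b / c)\<^sup>2 / (2 * s\<^sup>2))"
      by (simp only: exp_add)
    then show ?thesis using c by (simp add: normal_density_def s)
  qed
  have "has_bochner_integral lborel (normal_density (b / c) s) 1"
    using s by (simp add: has_bochner_integral_iff)
  then have "has_bochner_integral lborel (\<lambda>z. (sqrt (2 * pi / c) * exp (b\<^sup>2 / (2 * c))) * normal_density (b / c) s z)
      ((sqrt (2 * pi / c) * exp (b\<^sup>2 / (2 * c))) * 1)"
    by (intro has_bochner_integral_mult_right)
  then show ?thesis by (simp only: eq mult_1_right)
qed

lemma inner_vec_sum: "(x::real^'d) \<bullet> y = (\<Sum>j\<in>UNIV. x $ j * y $ j)"
  by (simp add: inner_vec_def)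

lemma norm_vec_sum: "(norm (x::real^'d))\<^sup>2 = (\<Sum>j\<in>UNIV. (x $ j)\<^sup>2)"
  unfolding power2_norm_eq_inner inner_vec_sum by (simp add: power2_eq_square)

lemma gaussian_integral:
  fixes b :: "real^'d"
  assumes c: "c > 0"
  shows "has_bochner_integral lborel (\<lambda>z. exp (b \<bullet> z - c * (norm z)\<^sup>2 / 2))
    ((2 * pi / c) powr (real CARD('d) / 2) * exp ((norm b)\<^sup>2 / (2 * c)))"
proof -
  note G = gaussian_integral_1[OF c]
  have "has_bochner_integral lborel (\<lambda>z::real^'d. \<Prod>j\<in>UNIV. exp (b $ j * z $ j - c * (z $ j)\<^sup>2 / 2))
    (\<Prod>j\<in>UNIV. integral\<^sup>L lborel (\<lambda>z. exp (b $ j * z - c * z\<^sup>2 / 2)))"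
    by (rule lborel_integral_prod_vec) (use G in \<open>blast intro: integrable.intros\<close>)
  moreover have "(\<Prod>j\<in>UNIV. integral\<^sup>L lborel (\<lambda>z. exp (b $ j * z - c * z\<^sup>2 / 2)))
      = sqrt (2 * pi / c) ^ CARD('d) * exp ((norm b)\<^sup>2 / (2 * c))"
    unfolding has_bochner_integral_integral_eq[OF G]
    by (simp add: prod.distrib exp_sum[symmetric]
        power2_norm_eq_inner inner_vec_sum sum_divide_distrib[symmetric] power2_eq_square[of "b $ _"])
  moreover have "sqrt (2 * pi / c) ^ CARD('d) = (2 * pi / c) powr (real CARD('d) / 2)"
    using c by (simp add: powr_half_sqrt[symmetric] powr_realpow[symmetric] powr_powr)
  moreover have "(\<Prod>j\<in>UNIV. exp (b $ j * z $ j - c * (z $ j)\<^sup>2 / 2)) = exp (b \<bullet> z - c * (norm z)\<^sup>2 / 2)" for z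
    by (simp add: exp_sum[symmetric] norm_vec_sum inner_vec_sum sum_divide_distrib sum_subtractf sum_distrib_left)
  ultimately show ?thesis by simp
qed

section \<open>The Gaussian probability measure\<close>

lemma gauss_density_pos: "gauss_density x > 0"
  by (simp add: gauss_density_def)

lemma gauss_density_measurable[measurable]: "gauss_density \<in> borel_measurable borel"
  unfolding gauss_density_def[abs_def] by measurable

lemma sets_gauss_measure[simp, measurable_cong]: "sets gauss_measure = sets borel"
  by (simp add: gauss_measure_def)

lemma space_gauss_measure[simp]: "space gauss_measure = UNIV"
  by (simp add: gauss_measure_def)

lemma AE_gauss_measure: "(AE x in gauss_measure. P x) \<longleftrightarrow> (AE x in lborel. P x)"
  unfolding gauss_measure_def by (subst AE_density) (auto simp: gauss_density_pos)

lemma integral_gauss_measure: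
  fixes f :: "real^'d \<Rightarrow> real"
  assumes [measurable]: "f \<in> borel_measurable borel"
  shows "(\<integral>x. f x \<partial>gauss_measure) = (\<integral>x. gauss_density x * f x \<partial>lborel)"
  unfolding gauss_measure_def
  by (subst integral_density) (auto simp: gauss_density_pos less_imp_le)

lemma integrable_gauss_measure:
  fixes f :: "real^'d \<Rightarrow> real"
  assumes [measurable]: "f \<in> borel_measurable borel"
  shows "integrable gauss_measure f \<longleftrightarrow> integrable lborel (\<lambda>x. gauss_density x * f x)"
  unfolding gauss_measure_def
  by (subst integrable_density) (auto simp: gauss_density_pos less_imp_le)

text \<open>All Gaussian computations below are instances: total mass one, normalization and
  composition of the Mehler kernel, and integrability of \<open>exp (e * (norm x)\<^sup>2)\<close>
  for \<open>e < 1 / 2\<close>. The condition on \<open>c\<close> keeps the total quadratic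
  coefficient \<open>1 + c\<close> positive.\<close>

lemma gauss_measure_exp:
  fixes b :: "real^'d"
  assumes c: "c > -1"
  shows "has_bochner_integral gauss_measure (\<lambda>z. exp (b \<bullet> z - c * (norm z)\<^sup>2 / 2))
    ((1 + c) powr (- real CARD('d) / 2) * exp ((norm b)\<^sup>2 / (2 * (1 + c))))"
proof -
  have "has_bochner_integral lborel (\<lambda>z. exp (b \<bullet> z - (1 + c) * (norm z)\<^sup>2 / 2))
    ((2 * pi / (1 + c)) powr (real CARD('d) / 2) * exp ((norm b)\<^sup>2 / (2 * (1 + c))))"
    using gaussian_integral[of "1 + c" b] c by simp
  then have "has_bochner_integral lborel (\<lambda>z. (2 * pi) powr (- real CARD('d) / 2) * exp (b \<bullet> z - (1 + c) * (norm z)\<^sup>2 / 2))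
    ((2 * pi) powr (- real CARD('d) / 2) * ((2 * pi / (1 + c)) powr (real CARD('d) / 2)
      * exp ((norm b)\<^sup>2 / (2 * (1 + c)))))"
    by (intro has_bochner_integral_mult_right)
  moreover have "(2 * pi) powr (- real CARD('d) / 2) * exp (b \<bullet> z - (1 + c) * (norm z)\<^sup>2 / 2)
      = gauss_density z * exp (b \<bullet> z - c * (norm z)\<^sup>2 / 2)" for z
    by (simp add: gauss_density_def exp_add[symmetric] field_simps)
  ultimately have "has_bochner_integral lborel (\<lambda>z. gauss_density z * exp (b \<bullet> z - c * (norm z)\<^sup>2 / 2))
    ((2 * pi) powr (- real CARD('d) / 2) * ((2 * pi / (1 + c)) powr (real CARD('d) / 2)
      * exp ((norm b)\<^sup>2 / (2 * (1 + c)))))"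
    by simp
  moreover have "(2 * pi) powr (- real CARD('d) / 2) * (2 * pi / (1 + c)) powr (real CARD('d) / 2)
      = (1 + c) powr (- real CARD('d) / 2)"
    using c by (simp add: powr_divide powr_minus field_simps)
  ultimately show ?thesis
    by (simp add: has_bochner_integral_iff integrable_gauss_measure integral_gauss_measure mult.assoc[symmetric])
qed

lemma prob_space_gauss_measure: "prob_space (gauss_measure :: (real^'d) measure)"
proof
  have "has_bochner_integral gauss_measure (\<lambda>z::real^'d. 1::real) 1"
    using gauss_measure_exp[of 0 "0::real^'d"] by simp
  then have "integrable (gauss_measure::(real^'d) measure) (\<lambda>z. 1::real)" "(\<integral>z. (1::real) \<partial>(gauss_measure::(real^'d) measure)) = 1"
    by (auto simp: has_bochner_integral_iff)
  then have "(\<integral>\<^sup>+z. ennreal 1 \<partial>(gauss_measure::(real^'d) measure)) = 1"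
    by (subst nn_integral_eq_integral) auto
  then show "emeasure (gauss_measure :: (real^'d) measure) (space gauss_measure) = 1" by simp
qed

interpretation gauss: prob_space "gauss_measure :: (real^'d) measure"
  by (rule prob_space_gauss_measure)

interpretation gauss2: pair_prob_space "gauss_measure :: (real^'d) measure" "gauss_measure :: (real^'d) measure" ..

subsection \<open>Hermite polynomials\<close>

text \<open>The unnormalized probabilists' Hermite polynomials; \<open>hermite_eq\<close> relates
  them to \<open>hermite\<close>. The recurrence makes induction and multiplication by
  \<open>y\<close> easy, which iterated derivatives do not.\<close>

fun he :: "nat \<Rightarrow> real \<Rightarrow> real" where
  "he 0 y = 1"
| "he (Suc 0) y = y"
| "he (Suc (Suc m)) y = y * he (Suc m) y - real (Suc m) * he m y"

text \<open>At \<open>m = 0\<close> the truncated \<open>m - 1\<close> is harmless because it is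
  multiplied by \<open>real m = 0\<close>.\<close>

lemma mult_he: "y * he m y = he (Suc m) y + real m * he (m - 1) y"
  by (cases m) auto

lemma has_real_derivative_he:
  "(he m has_real_derivative real m * he (m - 1) y) (at y)"
proof (induction m y rule: he.induct)
  case (3 m y)
  have "((\<lambda>y. y * he (Suc m) y - real (Suc m) * he m y) has_real_derivative
      (1 * he (Suc m) y + (real (Suc m) * he (Suc m - 1) y) * y)
       - real (Suc m) * (real m * he (m - 1) y)) (at y)"
    by (intro DERIV_diff DERIV_mult DERIV_ident DERIV_cmult 3)
  moreover have "(1 * he (Suc m) y + (real (Suc m) * he (Suc m - 1) y) * y)
       - real (Suc m) * (real m * he (m - 1) y) = real (Suc (Suc m)) * he (Suc m) y"
    using mult_he[of y m] unfolding of_nat_Suc diff_Suc_1 he.simps(3) by algebra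
  moreover have "he (Suc (Suc m)) = (\<lambda>y. y * he (Suc m) y - real (Suc m) * he m y)" by auto
  ultimately show ?case by simp
next
  case (1 y)
  have "he 0 = (\<lambda>_. 1)" by auto
  then show ?case by simp
next
  case (2 y)
  have "he (Suc 0) = (\<lambda>y. y)" by auto
  then show ?case by simp
qed

lemma has_real_derivative_he_exp:
  "((\<lambda>y. he m y * exp (- y\<^sup>2 / 2)) has_real_derivative - (he (Suc m) y * exp (- y\<^sup>2 / 2))) (at y)"
proof -
  have "((\<lambda>y::real. exp (- y\<^sup>2 / 2)) has_real_derivative exp (- y\<^sup>2 / 2) * - y) (at y)"
    by (auto intro!: derivative_eq_intros)
  from DERIV_mult[OF has_real_derivative_he[of m y] this] show ?thesis
    using arg_cong[OF mult_he[of y m], of "\<lambda>z. z * exp (- y\<^sup>2 / 2)"] by (simp add: algebra_simps)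
qed

text \<open>Rodrigues' formula, which links the definition of \<open>hermite\<close> to the
  recurrence.\<close>

lemma deriv_iterate_gauss:
  "(deriv ^^ m) (\<lambda>z. exp (- z\<^sup>2 / 2)) = (\<lambda>y. (-1) ^ m * (he m y * exp (- y\<^sup>2 / 2)))"
proof (induction m)
  case (Suc m)
  have "deriv (\<lambda>y. (-1) ^ m * (he m y * exp (- y\<^sup>2 / 2))) y
      = (-1) ^ m * - (he (Suc m) y * exp (- y\<^sup>2 / 2))" for y
    by (intro DERIV_imp_deriv DERIV_cmult has_real_derivative_he_exp)
  moreover have "(deriv ^^ Suc m) (\<lambda>z. exp (- z\<^sup>2 / 2)) = deriv (\<lambda>y. (-1) ^ m * (he m y * exp (- y\<^sup>2 / 2)))"
    using Suc by simp
  ultimately show ?case by (simp add: fun_eq_iff del: he.simps)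
qed simp

lemma hermite_eq: "hermite m y = he m y / sqrt (fact m)"
proof -
  have "(-1::real) ^ m * (-1) ^ m = 1"
    by (simp add: power_mult_distrib[symmetric])
  moreover have "exp (y\<^sup>2 / 2) * exp (- y\<^sup>2 / 2) = 1"
    by (simp add: exp_add[symmetric])
  moreover have "hermite m y = (((-1::real) ^ m * (-1) ^ m) * (exp (y\<^sup>2 / 2) * exp (- y\<^sup>2 / 2))) * he m y / sqrt (fact m)"
    unfolding hermite_def deriv_iterate_gauss by simp
  ultimately show ?thesis by (simp only: mult_1)
qed

lemma continuous_on_he[continuous_intros]: "continuous_on A (he m)"
  by (meson DERIV_isCont has_real_derivative_he continuous_at_imp_continuous_on)

lemma he_measurable[measurable]: "he m \<in> borel_measurable borel"
  by (intro borel_measurable_continuous_onI continuous_on_he)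

lemma abs_le_exp_square:
  fixes y :: real
  assumes e: "e > 0"
  shows "\<bar>y\<bar> \<le> (1 + 1 / e) * exp (e * y\<^sup>2)"
proof -
  have "\<bar>y\<bar> \<le> 1 + y\<^sup>2"
    using abs_square_le_1[of y] sum_squares_bound[of "\<bar>y\<bar>" 1] by simp
  also have "\<dots> \<le> (1 + 1 / e) * (1 + e * y\<^sup>2)"
    using e by (simp add: field_simps)
  also have "\<dots> \<le> (1 + 1 / e) * exp (e * y\<^sup>2)"
    using e by (intro mult_left_mono exp_ge_add_one_self) auto
  finally show ?thesis .
qed

text \<open>Growth below every Gaussian is all that the integrability arguments need. In the
  recurrence the exponent \<open>e\<close> is shared equally between the factor \<open>y\<close> and
  \<open>he (Suc k) y\<close>.\<close>

lemma he_bound: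
  "e > 0 \<Longrightarrow> \<exists>C>0. \<forall>y. \<bar>he m y\<bar> \<le> C * exp (e * y\<^sup>2)"
proof (induction m arbitrary: e rule: less_induct)
  case (less m)
  consider "m = 0" | "m = 1" | k where "m = Suc (Suc k)" by (metis One_nat_def not0_implies_Suc)
  then show ?case
  proof cases
    case 1
    then show ?thesis using less by (intro exI[of _ 1]) auto
  next
    case 2
    then show ?thesis using less abs_le_exp_square[of e] by (intro exI[of _ "1 + 1 / e"]) (auto intro: add_pos_pos)
  next
    case 3
    obtain C where C: "C > 0" "\<And>y. \<bar>he (Suc k) y\<bar> \<le> C * exp (e / 2 * y\<^sup>2)"
      using less(1)[of "Suc k" "e / 2"] less(2) 3 by auto
    obtain D where D: "D > 0" "\<And>y. \<bar>he k y\<bar> \<le> D * exp (e * y\<^sup>2)"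
      using less(1)[of k e] less(2) 3 by auto
    let ?A = "1 + 1 / (e / 2)"
    have A: "?A > 0" using less(2) by (intro add_pos_pos) auto
    have "\<bar>he m y\<bar> \<le> (?A * C + real (Suc k) * D) * exp (e * y\<^sup>2)" for y
    proof -
      have "\<bar>he m y\<bar> \<le> \<bar>y\<bar> * \<bar>he (Suc k) y\<bar> + real (Suc k) * \<bar>he k y\<bar>"
        using abs_triangle_ineq4[of "y * he (Suc k) y" "real (Suc k) * he k y"]
        by (simp add: 3 abs_mult)
      also have "\<dots> \<le> (?A * exp (e / 2 * y\<^sup>2)) * (C * exp (e / 2 * y\<^sup>2)) + real (Suc k) * (D * exp (e * y\<^sup>2))"
        using A less(2) by (intro add_mono mult_mono C D abs_le_exp_square mult_left_mono) auto
      also have "\<dots> = (?A * C + real (Suc k) * D) * exp (e * y\<^sup>2)"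
      proof -
        have "exp (e * y\<^sup>2) = exp (e / 2 * y\<^sup>2) * exp (e / 2 * y\<^sup>2)"
          by (simp add: exp_add[symmetric] field_simps)
        then show ?thesis by (simp add: algebra_simps)
      qed
      finally show ?thesis .
    qed
    moreover have "?A * C + real (Suc k) * D > 0" using A C(1) D(1) by (meson add_pos_pos mult_pos_pos of_nat_0_less_iff zero_less_Suc)
    ultimately show ?thesis by blast
  qed
qed

lemma integrable_he_exp: "integrable lborel (\<lambda>y. he m y * exp (- y\<^sup>2 / 2))"
proof -
  obtain C where C: "C > 0" "\<And>y. \<bar>he m y\<bar> \<le> C * exp (1 / 4 * y\<^sup>2)"
    using he_bound[of "1/4" m] by auto
  have "integrable lborel (\<lambda>y::real. C * exp (0 * y - (1 / 2) * y\<^sup>2 / 2))"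
    by (intro integrable_mult_right integrable.intros[OF gaussian_integral_1]) simp
  then show ?thesis
  proof (rule Bochner_Integration.integrable_bound)
    show "AE y in lborel. norm (he m y * exp (- y\<^sup>2 / 2)) \<le> norm (C * exp (0 * y - (1 / 2) * y\<^sup>2 / 2))"
    proof (rule AE_I2)
      fix y :: real
      have "\<bar>he m y\<bar> * exp (- y\<^sup>2 / 2) \<le> (C * exp (1 / 4 * y\<^sup>2)) * exp (- y\<^sup>2 / 2)"
        by (intro mult_right_mono C) auto
      also have "\<dots> = C * exp (0 * y - (1 / 2) * y\<^sup>2 / 2)"
        by (simp add: exp_add[symmetric])
      finally show "norm (he m y * exp (- y\<^sup>2 / 2)) \<le> norm (C * exp (0 * y - (1 / 2) * y\<^sup>2 / 2))"
        using C(1) by (simp add: abs_mult)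
    qed
  qed measurable
qed

lemma tendsto_he_exp:
  assumes F: "filterlim (\<lambda>y::real. y\<^sup>2) at_top F"
  shows "((\<lambda>y. he m y * exp (- y\<^sup>2 / 2)) \<longlongrightarrow> 0) F"
proof -
  obtain C where C: "C > 0" "\<And>y. \<bar>he m y\<bar> \<le> C * exp (1 / 4 * y\<^sup>2)"
    using he_bound[of "1/4" m] by auto
  have "((\<lambda>z::real. C * exp (- z / 4)) \<longlongrightarrow> 0) at_top" by real_asymp
  then have lim: "((\<lambda>y::real. C * exp (- y\<^sup>2 / 4)) \<longlongrightarrow> 0) F"
    by (rule filterlim_compose[OF _ F])
  have "norm (he m y * exp (- y\<^sup>2 / 2)) \<le> C * exp (- y\<^sup>2 / 4)" for y
  proof -
    have "\<bar>he m y\<bar> * exp (- y\<^sup>2 / 2) \<le> (C * exp (1 / 4 * y\<^sup>2)) * exp (- y\<^sup>2 / 2)"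
      by (intro mult_right_mono C) auto
    also have "\<dots> = C * exp (- y\<^sup>2 / 4)"
      by (simp add: exp_add[symmetric])
    finally show ?thesis by (simp add: abs_mult)
  qed
  then have "eventually (\<lambda>y. norm (he m y * exp (- y\<^sup>2 / 2)) \<le> C * exp (- y\<^sup>2 / 4)) F"
    by (intro always_eventually allI)
  then show ?thesis using lim by (rule Lim_null_comparison)
qed

text \<open>The integrand is minus the derivative of \<open>he m y * exp (- y\<^sup>2 / 2)\<close>,
  which tends to 0 at both ends of the line.\<close>

lemma integral_he_exp: "(\<integral>y. he (Suc m) y * exp (- y\<^sup>2 / 2) \<partial>lborel) = 0"
proof -
  have "(LBINT y=-\<infinity>..\<infinity>. - (he (Suc m) y * exp (- y\<^sup>2 / 2))) = 0 - 0"
  proof (rule interval_integral_FTC_integrable)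
    show "((\<lambda>y. he m y * exp (- y\<^sup>2 / 2)) has_vector_derivative - (he (Suc m) y * exp (- y\<^sup>2 / 2))) (at y)" for y
      using has_real_derivative_he_exp by (simp add: has_real_derivative_iff_has_vector_derivative)
    show "isCont (\<lambda>y. - (he (Suc m) y * exp (- y\<^sup>2 / 2))) y" for y
      by (intro continuous_intros DERIV_isCont[OF has_real_derivative_he]) simp
    show "set_integrable lborel (einterval (-\<infinity>) \<infinity>) (\<lambda>y. - (he (Suc m) y * exp (- y\<^sup>2 / 2)))"
      using integrable_he_exp[of "Suc m"] by (simp add: set_integrable_def del: he.simps)
    show "(((\<lambda>y. he m y * exp (- y\<^sup>2 / 2)) \<circ> real_of_ereal) \<longlongrightarrow> 0) (at_right (-\<infinity>))"
      unfolding ereal_tendsto_simps1 by (rule tendsto_he_exp) real_asymp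
    show "(((\<lambda>y. he m y * exp (- y\<^sup>2 / 2)) \<circ> real_of_ereal) \<longlongrightarrow> 0) (at_left \<infinity>)"
      unfolding ereal_tendsto_simps1 by (rule tendsto_he_exp) real_asymp
  qed simp
  then show ?thesis
    by (simp add: interval_lebesgue_integral_def set_lebesgue_integral_def del: he.simps)
qed

definition multi_he :: "('d \<Rightarrow> nat) \<Rightarrow> real^'d \<Rightarrow> real" where
  "multi_he k x = (\<Prod>j\<in>UNIV. he (k j) (x $ j))"

lemma multi_hermite_eq: "multi_hermite k x = multi_he k x / (\<Prod>j\<in>UNIV. sqrt (fact (k j)))"
  by (simp add: multi_hermite_def multi_he_def hermite_eq prod_dividef)

lemma integral_multi_he:
  fixes k :: "'d::finite \<Rightarrow> nat"
  assumes k: "k i > 0"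
  shows "(\<integral>x. multi_he k x \<partial>gauss_measure) = 0"
proof -
  have "has_bochner_integral lborel (\<lambda>x::real^'d. \<Prod>j\<in>UNIV. he (k j) (x $ j) * exp (- (x $ j)\<^sup>2 / 2))
     (\<Prod>j\<in>UNIV. integral\<^sup>L lborel (\<lambda>y. he (k j) y * exp (- y\<^sup>2 / 2)))"
    by (rule lborel_integral_prod_vec) (rule integrable_he_exp)
  moreover have "(\<Prod>j\<in>UNIV. integral\<^sup>L lborel (\<lambda>y. he (k j) y * exp (- y\<^sup>2 / 2))) = 0"
    using k integral_he_exp[of "k i - 1"] by (auto intro!: prod_zero exI[of _ i])
  ultimately have *: "(\<integral>x. (\<Prod>j\<in>UNIV. he (k j) (x $ j) * exp (- (x $ j)\<^sup>2 / 2)) \<partial>(lborel::(real^'d) measure)) = 0"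
    by (simp add: has_bochner_integral_iff)
  have "gauss_density x * multi_he k x = (2 * pi) powr (- real CARD('d) / 2) *
      (\<Prod>j\<in>UNIV. he (k j) (x $ j) * exp (- (x $ j)\<^sup>2 / 2))" for x
    by (simp add: gauss_density_def multi_he_def prod.distrib exp_sum[symmetric] norm_vec_sum
        sum_divide_distrib[symmetric] sum_negf)
  moreover have "multi_he k \<in> borel_measurable borel"
    unfolding multi_he_def[abs_def] by measurable
  ultimately show ?thesis using * by (simp add: integral_gauss_measure)
qed

text \<open>Polynomials of degree at most \<open>N\<close>, presented as the span of the Hermite polynomials.\<close>

inductive hpoly :: "nat \<Rightarrow> (real^'d \<Rightarrow> real) \<Rightarrow> bool" for N where
  base: "(\<Sum>j\<in>UNIV. k j) \<le> N \<Longrightarrow> hpoly N (multi_he k)"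
| add: "hpoly N g \<Longrightarrow> hpoly N h \<Longrightarrow> hpoly N (\<lambda>x. g x + h x)"
| scale: "hpoly N g \<Longrightarrow> hpoly N (\<lambda>x. c * g x)"

lemma hpoly_mono: "hpoly N g \<Longrightarrow> N \<le> M \<Longrightarrow> hpoly M g"
  by (induction rule: hpoly.induct) (auto intro: hpoly.intros)

lemma hpoly_const: "hpoly N (\<lambda>x. c)"
proof -
  have "hpoly N (multi_he (\<lambda>_. 0))" by (rule hpoly.base) simp
  from hpoly.scale[OF this, of c] show ?thesis by (simp add: multi_he_def)
qed

lemma hpoly_sum: "(\<And>i. i \<in> A \<Longrightarrow> hpoly N (g i)) \<Longrightarrow> hpoly N (\<lambda>x. \<Sum>i\<in>A. g i x)"
  by (induction A rule: infinite_finite_induct) (auto intro: hpoly.add hpoly_const)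

text \<open>The recurrence \<open>mult_he\<close> in coordinate \<open>i\<close> alone rewrites the
  product as a combination of two Hermite products. This puts monomials into the span directly,
  without inverting the change of basis between monomials and Hermite polynomials.\<close>

lemma hpoly_mult_coord:
  "hpoly N g \<Longrightarrow> hpoly (Suc N) (\<lambda>x. x $ i * g x)"
proof (induction rule: hpoly.induct)
  case (base k)
  let ?p = "k(i := Suc (k i))" and ?m = "k(i := k i - 1)"
  have s: "(\<Sum>j\<in>UNIV. l j) = l i + (\<Sum>j\<in>UNIV - {i}. l j)" for l :: "'a \<Rightarrow> nat"
    by (rule sum.remove) auto
  have m: "multi_he l x = he (l i) (x $ i) * (\<Prod>j\<in>UNIV - {i}. he (l j) (x $ j))" for l x
    unfolding multi_he_def by (rule prod.remove) auto
  have "hpoly (Suc N) (multi_he ?p)" "hpoly (Suc N) (multi_he ?m)"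
    using base s[of k] s[of ?p] s[of ?m] by (auto intro!: hpoly.base)
  then have "hpoly (Suc N) (\<lambda>x. multi_he ?p x + real (k i) * multi_he ?m x)"
    by (intro hpoly.add hpoly.scale)
  moreover have "x $ i * multi_he k x = multi_he ?p x + real (k i) * multi_he ?m x" for x
  proof -
    let ?R = "\<Prod>j\<in>UNIV - {i}. he (k j) (x $ j)"
    have "(\<Prod>j\<in>UNIV - {i}. he (?p j) (x $ j)) = ?R" "(\<Prod>j\<in>UNIV - {i}. he (?m j) (x $ j)) = ?R"
      by (auto intro: prod.cong)
    then have "multi_he ?p x + real (k i) * multi_he ?m x = (he (Suc (k i)) (x $ i) + real (k i) * he (k i - 1) (x $ i)) * ?R"
      unfolding m by (simp add: distrib_right del: he.simps)
    then show ?thesis by (simp only: m[of k] mult_he[symmetric] mult.assoc)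
  qed
  ultimately show ?case by simp
next
  case (add g h)
  from hpoly.add[OF add.IH] show ?case by (simp add: distrib_left)
next
  case (scale g c)
  from hpoly.scale[OF scale.IH, of c] show ?case by (simp add: mult.left_commute)
qed

lemma hpoly_mult_inner: "hpoly N g \<Longrightarrow> hpoly (Suc N) (\<lambda>x. (a \<bullet> x) * g x)"
  unfolding inner_vec_sum sum_distrib_right mult.assoc
  by (intro hpoly_sum hpoly.scale hpoly_mult_coord)

lemma hpoly_mult_norm: "hpoly N g \<Longrightarrow> hpoly (Suc (Suc N)) (\<lambda>x. (norm x)\<^sup>2 * g x)"
  unfolding power2_norm_eq_inner inner_vec_sum sum_distrib_right mult.assoc
  by (intro hpoly_sum hpoly_mult_coord)

lemma hpoly_inner_norm: "hpoly (p + 2 * q) (\<lambda>x. (a \<bullet> x) ^ p * ((norm x)\<^sup>2) ^ q)"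
proof (induction p)
  case 0
  show ?case
  proof (induction q)
    case (Suc q)
    from hpoly_mult_norm[OF Suc] show ?case by simp
  qed (simp add: hpoly_const)
next
  case (Suc p)
  from hpoly_mult_inner[OF Suc] show ?case by (simp add: mult.assoc)
qed

lemma hpoly_measurable[measurable_dest]: "hpoly N g \<Longrightarrow> g \<in> borel_measurable borel"
proof (induction rule: hpoly.induct)
  case (base k)
  show ?case unfolding multi_he_def[abs_def] by measurable
qed auto

lemma hpoly_bound:
  assumes "hpoly N g" "e > 0"
  shows "\<exists>C. \<forall>x. \<bar>g x\<bar> \<le> C * exp (e * (norm x)\<^sup>2)"
  using assms
proof (induction rule: hpoly.induct)
  case (base k)
  have "\<forall>j. \<exists>C. \<forall>y. \<bar>he (k j) y\<bar> \<le> C * exp (e * y\<^sup>2)"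
    using he_bound[OF base(2)] by blast
  then obtain C where C: "\<And>j y. \<bar>he (k j) y\<bar> \<le> C j * exp (e * y\<^sup>2)" by metis
  have "\<bar>multi_he k x\<bar> \<le> (\<Prod>j\<in>UNIV. C j) * exp (e * (norm x)\<^sup>2)" for x
  proof -
    have "\<bar>multi_he k x\<bar> \<le> (\<Prod>j\<in>UNIV. C j * exp (e * (x $ j)\<^sup>2))"
      unfolding multi_he_def abs_prod by (intro prod_mono conjI C) auto
    also have "\<dots> = (\<Prod>j\<in>UNIV. C j) * exp (e * (norm x)\<^sup>2)"
      by (simp add: prod.distrib exp_sum[symmetric] norm_vec_sum sum_distrib_left)
    finally show ?thesis .
  qed
  then show ?case by blast
next
  case (add g h)
  then obtain C D where "\<And>x. \<bar>g x\<bar> \<le> C * exp (e * (norm x)\<^sup>2)" "\<And>x. \<bar>h x\<bar> \<le> D * exp (e * (norm x)\<^sup>2)"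
    by blast
  then have "\<bar>g x + h x\<bar> \<le> (C + D) * exp (e * (norm x)\<^sup>2)" for x
    unfolding distrib_right by (meson abs_triangle_ineq add_mono order_trans)
  then show ?case by blast
next
  case (scale g c)
  then obtain C where C: "\<And>x. \<bar>g x\<bar> \<le> C * exp (e * (norm x)\<^sup>2)" by blast
  have "\<bar>c * g x\<bar> \<le> (\<bar>c\<bar> * C) * exp (e * (norm x)\<^sup>2)" for x
    unfolding abs_mult mult.assoc by (intro mult_left_mono C) auto
  then show ?case by blast
qed

lemma integrable_exp_norm:
  assumes "e < 1 / 2"
  shows "integrable gauss_measure (\<lambda>x::real^'d. exp (e * (norm x)\<^sup>2))"
proof -
  have "has_bochner_integral gauss_measure (\<lambda>z::real^'d. exp (0 \<bullet> z - (- 2 * e) * (norm z)\<^sup>2 / 2))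
    ((1 + (- 2 * e)) powr (- real CARD('d) / 2) * exp ((norm (0::real^'d))\<^sup>2 / (2 * (1 + (- 2 * e)))))"
    using assms by (intro gauss_measure_exp) simp
  then show ?thesis by (auto simp: has_bochner_integral_iff)
qed

lemma integrable_le_exp_norm:
  fixes g :: "real^'d \<Rightarrow> real"
  assumes [measurable]: "g \<in> borel_measurable borel"
    and b: "\<And>x. \<bar>g x\<bar> \<le> C * exp (e * (norm x)\<^sup>2)" and e: "e < 1 / 2"
  shows "integrable gauss_measure g"
proof (rule Bochner_Integration.integrable_bound)
  show "integrable gauss_measure (\<lambda>x::real^'d. C * exp (e * (norm x)\<^sup>2))"
    using integrable_exp_norm[OF e] by (intro integrable_mult_right)
  show "AE x in gauss_measure. norm (g x) \<le> norm (C * exp (e * (norm x)\<^sup>2))"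
    using b by (intro AE_I2) (simp, smt (verit))
qed measurable

lemma integrable_bounded_hpoly:
  fixes f g :: "real^'d \<Rightarrow> real"
  assumes [measurable]: "f \<in> borel_measurable borel" and f: "\<And>x. \<bar>f x\<bar> \<le> B" and g: "hpoly N g"
  shows "integrable gauss_measure (\<lambda>x. f x * g x)"
proof -
  note [measurable] = hpoly_measurable[OF g]
  obtain C where C: "\<And>x. \<bar>g x\<bar> \<le> C * exp (1/4 * (norm x)\<^sup>2)"
    using hpoly_bound[OF g, of "1/4"] by auto
  show ?thesis
  proof (rule integrable_le_exp_norm)
    fix x
    have "\<bar>f x * g x\<bar> \<le> B * (C * exp (1/4 * (norm x)\<^sup>2))"
      unfolding abs_mult using f[of x] by (intro mult_mono C) auto
    then show "\<bar>f x * g x\<bar> \<le> (B * C) * exp (1/4 * (norm x)\<^sup>2)" by (simp add: mult.assoc)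
  qed auto
qed

lemma integral_hpoly_eq_0:
  fixes f g :: "real^'d \<Rightarrow> real"
  assumes f: "f \<in> borel_measurable borel" "\<And>x. \<bar>f x\<bar> \<le> B"
    and orth: "\<And>k. (\<Sum>j\<in>UNIV. k j) \<le> N \<Longrightarrow> (\<integral>x. f x * multi_he k x \<partial>gauss_measure) = 0"
    and g: "hpoly N g"
  shows "(\<integral>x. f x * g x \<partial>gauss_measure) = 0"
  using g
proof (induction rule: hpoly.induct)
  case (add g h)
  then show ?case
    by (simp add: distrib_left integrable_bounded_hpoly[OF f] Bochner_Integration.integral_add)
next
  case (scale g c)
  then show ?case by (simp add: mult.left_commute)
qed (rule orth)

subsection \<open>The Mehler kernel and the Ornstein-Uhlenbeck semigroup\<close>

text \<open>For \<open>r\<^sup>2 < 1\<close> this is the density, relative to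
  \<open>gauss_measure\<close> rather than to Lebesgue measure, of the normal law with mean
  \<open>r x\<close> and covariance \<open>1 - r\<^sup>2\<close> times the identity. Relative to the
  Gaussian measure the kernel is symmetric.\<close>

definition mehler :: "real \<Rightarrow> real^'d \<Rightarrow> real^'d \<Rightarrow> real" where
  "mehler r x y = (1 - r\<^sup>2) powr (- real CARD('d) / 2) *
     exp ((2 * r * (x \<bullet> y) - r\<^sup>2 * ((norm x)\<^sup>2 + (norm y)\<^sup>2)) / (2 * (1 - r\<^sup>2)))"

lemma mehler_sym: "mehler r x y = mehler r y x"
  by (simp add: mehler_def inner_commute add.commute)

lemma mehler_nonneg: "0 \<le> mehler r x y"
  by (simp add: mehler_def)

lemma mehler_pos: "r\<^sup>2 < 1 \<Longrightarrow> 0 < mehler r x y"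
  by (simp add: mehler_def)

lemma mehler_measurable_pair[measurable]:
  "(\<lambda>(x, y). mehler r x y) \<in> borel_measurable (borel \<Otimes>\<^sub>M borel)"
  unfolding mehler_def by measurable

lemma mehler_measurable[measurable]: "mehler r x \<in> borel_measurable borel"
  unfolding mehler_def[abs_def] by measurable

text \<open>Isolates the dependence on \<open>y\<close> in the form that
  \<open>gauss_measure_exp\<close> integrates.\<close>

lemma mehler_split:
  assumes r: "r\<^sup>2 < 1"
  shows "mehler r (x::real^'d) y = (1 - r\<^sup>2) powr (- real CARD('d) / 2) * exp (- r\<^sup>2 * (norm x)\<^sup>2 / (2 * (1 - r\<^sup>2)))
    * exp (((r / (1 - r\<^sup>2)) *\<^sub>R x) \<bullet> y - (r\<^sup>2 / (1 - r\<^sup>2)) * (norm y)\<^sup>2 / 2)"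
proof -
  have "(2 * r * (x \<bullet> y) - r\<^sup>2 * ((norm x)\<^sup>2 + (norm y)\<^sup>2)) / (2 * (1 - r\<^sup>2))
    = - r\<^sup>2 * (norm x)\<^sup>2 / (2 * (1 - r\<^sup>2)) + (((r / (1 - r\<^sup>2)) *\<^sub>R x) \<bullet> y - (r\<^sup>2 / (1 - r\<^sup>2)) * (norm y)\<^sup>2 / 2)"
  proof -
    define p where "p = 1 - r\<^sup>2"
    have "p \<noteq> 0" using r by (simp add: p_def)
    then show ?thesis unfolding p_def[symmetric] by (simp add: field_simps)
  qed
  then show ?thesis by (simp only: mehler_def exp_add mult.assoc)
qed

lemma mehler_integral:
  assumes r: "r\<^sup>2 < 1"
  shows "has_bochner_integral gauss_measure (mehler r (x::real^'d)) 1"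
proof -
  let ?K = "(1 - r\<^sup>2) powr (- real CARD('d) / 2) * exp (- r\<^sup>2 * (norm x)\<^sup>2 / (2 * (1 - r\<^sup>2)))"
  let ?b = "(r / (1 - r\<^sup>2)) *\<^sub>R x" and ?c = "r\<^sup>2 / (1 - r\<^sup>2)"
  have c: "?c > -1" using r by (intro less_le_trans[OF _ divide_nonneg_pos]) auto
  have c1: "1 + ?c = 1 / (1 - r\<^sup>2)" using r by (simp add: field_simps)
  have "has_bochner_integral gauss_measure (\<lambda>y. ?K * exp (?b \<bullet> y - ?c * (norm y)\<^sup>2 / 2))
    (?K * ((1 + ?c) powr (- real CARD('d) / 2) * exp ((norm ?b)\<^sup>2 / (2 * (1 + ?c)))))"
    by (intro has_bochner_integral_mult_right gauss_measure_exp c)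
  moreover have "mehler r x = (\<lambda>y. ?K * exp (?b \<bullet> y - ?c * (norm y)\<^sup>2 / 2))"
    by (rule ext) (rule mehler_split[OF r])
  moreover have "(norm ?b)\<^sup>2 / (2 * (1 + ?c)) = r\<^sup>2 * (norm x)\<^sup>2 / (2 * (1 - r\<^sup>2))"
    unfolding c1 using r by (simp add: power_mult_distrib power_divide power2_eq_square[of "1 - r\<^sup>2"])
  moreover have "(1 - r\<^sup>2) powr (- real CARD('d) / 2) * (1 + ?c) powr (- real CARD('d) / 2) = 1"
    unfolding c1 using r by (simp add: powr_divide)
  moreover have "exp (- r\<^sup>2 * (norm x)\<^sup>2 / (2 * (1 - r\<^sup>2))) * exp (r\<^sup>2 * (norm x)\<^sup>2 / (2 * (1 - r\<^sup>2))) = 1"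
    by (simp add: exp_add[symmetric])
  moreover have "?K * (P * E) = (((1 - r\<^sup>2) powr (- real CARD('d) / 2)) * P) * (exp (- r\<^sup>2 * (norm x)\<^sup>2 / (2 * (1 - r\<^sup>2))) * E)" for P E
    by simp
  ultimately show ?thesis by (simp only: mult_1)
qed

text \<open>The exponent computation for composing two Mehler kernels, with \<open>X\<close>,
  \<open>Y\<close>, \<open>Z\<close> in the roles of the two squared norms and the inner product.
  The coefficients of the three are compared separately.\<close>

lemma mehler_exponent_identity:
  fixes r s X Y Z :: real
  assumes r: "r\<^sup>2 < 1" and s: "s\<^sup>2 < 1"
  defines "p \<equiv> 1 - r\<^sup>2" and "q \<equiv> 1 - s\<^sup>2" and "t \<equiv> 1 - (r * s)\<^sup>2"
  shows "- r\<^sup>2 * X / (2 * p) - s\<^sup>2 * Y / (2 * q)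
      + ((r / p)\<^sup>2 * X + 2 * (r / p) * (s / q) * Z + (s / q)\<^sup>2 * Y) / (2 * (t / (p * q)))
    = (2 * (r * s) * Z - (r * s)\<^sup>2 * (X + Y)) / (2 * t)"
proof -
  have p: "p > 0" and q: "q > 0" using r s by (auto simp: p_def q_def)
  have "(r * s)\<^sup>2 < 1"
  proof -
    have "r\<^sup>2 * s\<^sup>2 \<le> 1 * s\<^sup>2" using r by (intro mult_right_mono) auto
    then show ?thesis using s by (simp add: power_mult_distrib)
  qed
  then have t: "t > 0" by (simp add: t_def)
  \<comment> \<open>These two factorizations produce the cancellation in the coefficients of
    \<open>X\<close> and \<open>Y\<close>.\<close>
  have tq: "q - t = - s\<^sup>2 * p" "p - t = - r\<^sup>2 * q"
    by (simp_all add: p_def q_def t_def power_mult_distrib algebra_simps)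
  have "- r\<^sup>2 * X / (2 * p) + (r / p)\<^sup>2 * X / (2 * (t / (p * q))) = r\<^sup>2 * X * (q - t) / (2 * p * t)"
    using p q t by (simp add: field_simps power2_eq_square)
  also have "\<dots> = - (r * s)\<^sup>2 * X / (2 * t)"
    unfolding tq using p t by (simp add: field_simps)
  finally have 1: "- r\<^sup>2 * X / (2 * p) + (r / p)\<^sup>2 * X / (2 * (t / (p * q))) = - (r * s)\<^sup>2 * X / (2 * t)" .
  have "- s\<^sup>2 * Y / (2 * q) + (s / q)\<^sup>2 * Y / (2 * (t / (p * q))) = s\<^sup>2 * Y * (p - t) / (2 * q * t)"
    using p q t by (simp add: field_simps power2_eq_square)
  also have "\<dots> = - (r * s)\<^sup>2 * Y / (2 * t)"
    unfolding tq using q t by (simp add: field_simps)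
  finally have 2: "- s\<^sup>2 * Y / (2 * q) + (s / q)\<^sup>2 * Y / (2 * (t / (p * q))) = - (r * s)\<^sup>2 * Y / (2 * t)" .
  have 3: "2 * (r / p) * (s / q) * Z / (2 * (t / (p * q))) = 2 * (r * s) * Z / (2 * t)"
    using p q t by (simp add: field_simps)
  show ?thesis
    using 1 2 3 by (simp only: add_divide_distrib diff_divide_distrib distrib_left)
qed

text \<open>As a function of \<open>z\<close> the product of the kernels is again the exponential of
  a linear minus a quadratic form. Its quadratic coefficient satisfies
  \<open>1 + c = t / (p * q)\<close>, so one Gaussian integral produces the kernel of parameter
  \<open>r * s\<close>.\<close>

lemma mehler_semigroup:
  assumes r: "r\<^sup>2 < 1" and s: "s\<^sup>2 < 1"
  shows "(\<integral>z. mehler r x z * mehler s z y \<partial>gauss_measure) = mehler (r * s) (x::real^'d) y"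
proof -
  define p q t where "p = 1 - r\<^sup>2" and "q = 1 - s\<^sup>2" and "t = 1 - (r * s)\<^sup>2"
  have p: "p > 0" and q: "q > 0" using r s by (auto simp: p_def q_def)
  have "r\<^sup>2 * s\<^sup>2 \<le> 1 * s\<^sup>2" using r by (intro mult_right_mono) auto
  then have t: "t > 0" using s by (simp add: t_def power_mult_distrib)
  let ?e = "- real CARD('d) / 2"
  let ?b = "(r / p) *\<^sub>R x + (s / q) *\<^sub>R y" and ?c = "r\<^sup>2 / p + s\<^sup>2 / q"
  let ?K = "p powr ?e * q powr ?e * exp (- r\<^sup>2 * (norm x)\<^sup>2 / (2 * p) - s\<^sup>2 * (norm y)\<^sup>2 / (2 * q))"
  have c: "?c > -1" using p q by (intro less_le_trans[OF _ add_nonneg_nonneg]) auto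
  have c1: "1 + ?c = t / (p * q)"
    using p q by (simp add: field_simps) (simp add: p_def q_def t_def algebra_simps power2_eq_square)
  have "mehler r x z * mehler s z y = ?K * exp (?b \<bullet> z - ?c * (norm z)\<^sup>2 / 2)" for z
    unfolding mehler_sym[of s z y] mehler_split[OF r] mehler_split[OF s] p_def[symmetric] q_def[symmetric]
    by (simp add: exp_add[symmetric] exp_diff[symmetric] inner_add_left inner_commute[of z] algebra_simps add_divide_distrib)
  then have "(\<integral>z. mehler r x z * mehler s z y \<partial>gauss_measure) =
      ?K * ((1 + ?c) powr ?e * exp ((norm ?b)\<^sup>2 / (2 * (1 + ?c))))"
    using has_bochner_integral_integral_eq[OF gauss_measure_exp[OF c, of ?b]] by simp
  also have "\<dots> = (p powr ?e * q powr ?e * (1 + ?c) powr ?e) *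
      exp (- r\<^sup>2 * (norm x)\<^sup>2 / (2 * p) - s\<^sup>2 * (norm y)\<^sup>2 / (2 * q) + (norm ?b)\<^sup>2 / (2 * (1 + ?c)))"
    by (simp only: exp_add mult_ac)
  also have "p powr ?e * q powr ?e * (1 + ?c) powr ?e = t powr ?e"
    unfolding c1 using p q t by (simp add: powr_divide powr_mult)
  also have "(norm ?b)\<^sup>2 = (r / p)\<^sup>2 * (norm x)\<^sup>2 + 2 * (r / p) * (s / q) * (x \<bullet> y) + (s / q)\<^sup>2 * (norm y)\<^sup>2"
    unfolding power2_norm_eq_inner
    by (simp add: inner_add_left inner_add_right inner_commute[of y x] power2_eq_square algebra_simps)
  also have "- r\<^sup>2 * (norm x)\<^sup>2 / (2 * p) - s\<^sup>2 * (norm y)\<^sup>2 / (2 * q) +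
      ((r / p)\<^sup>2 * (norm x)\<^sup>2 + 2 * (r / p) * (s / q) * (x \<bullet> y) + (s / q)\<^sup>2 * (norm y)\<^sup>2) / (2 * (1 + ?c))
    = (2 * (r * s) * (x \<bullet> y) - (r * s)\<^sup>2 * ((norm x)\<^sup>2 + (norm y)\<^sup>2)) / (2 * t)"
    unfolding c1 unfolding p_def q_def t_def by (rule mehler_exponent_identity[OF r s])
  finally show ?thesis by (simp only: mehler_def t_def)
qed

section \<open>Bounded Borel functions and the semigroup acting on them\<close>

definition bounded_borel :: "('a::topological_space \<Rightarrow> real) \<Rightarrow> bool" where
  "bounded_borel f \<longleftrightarrow> f \<in> borel_measurable borel \<and> (\<exists>B. \<forall>x. \<bar>f x\<bar> \<le> B)"

lemma bounded_borelD[measurable_dest]: "bounded_borel f \<Longrightarrow> f \<in> borel_measurable borel"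
  by (simp add: bounded_borel_def)

lemma bounded_borelI: "f \<in> borel_measurable borel \<Longrightarrow> (\<And>x. \<bar>f x\<bar> \<le> B) \<Longrightarrow> bounded_borel f"
  by (auto simp: bounded_borel_def)

lemma bounded_borel_mult:
  assumes "bounded_borel f" "bounded_borel g"
  shows "bounded_borel (\<lambda>x. f x * g x)"
proof -
  obtain A B where "\<And>x. \<bar>f x\<bar> \<le> A" "\<And>x. \<bar>g x\<bar> \<le> B" using assms by (auto simp: bounded_borel_def)
  then have "\<bar>f x * g x\<bar> \<le> \<bar>A\<bar> * \<bar>B\<bar>" for x unfolding abs_mult by (meson abs_ge_self abs_ge_zero mult_mono order_trans)
  moreover have "(\<lambda>x. f x * g x) \<in> borel_measurable borel" using assms by measurable
  ultimately show ?thesis by (rule bounded_borelI[rotated])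
qed

lemma bounded_borel_square: "bounded_borel f \<Longrightarrow> bounded_borel (\<lambda>x. (f x)\<^sup>2)"
  unfolding power2_eq_square by (intro bounded_borel_mult)

lemma bounded_borel_minus_const:
  assumes "bounded_borel f"
  shows "bounded_borel (\<lambda>x. f x - c)"
proof -
  obtain A where "\<And>x. \<bar>f x\<bar> \<le> A" using assms by (auto simp: bounded_borel_def)
  then have "\<bar>f x - c\<bar> \<le> A + \<bar>c\<bar>" for x by (meson abs_triangle_ineq4 add_right_mono order_trans)
  moreover have "(\<lambda>x. f x - c) \<in> borel_measurable borel" using assms by measurable
  ultimately show ?thesis by (rule bounded_borelI[rotated])
qed

lemma bounded_borel_integrable: "bounded_borel f \<Longrightarrow> integrable gauss_measure f"
  unfolding bounded_borel_def
  by (elim conjE exE) (rule gauss.integrable_const_bound, auto)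

lemma integrable_mehler_mult:
  assumes f: "bounded_borel f" and r: "r\<^sup>2 < 1"
  shows "integrable gauss_measure (\<lambda>y. f y * mehler r x y)"
proof -
  obtain B where B: "\<And>x. \<bar>f x\<bar> \<le> B" using f by (auto simp: bounded_borel_def)
  note [measurable] = bounded_borelD[OF f]
  have "integrable gauss_measure (\<lambda>y. B * mehler r x y)"
    using mehler_integral[OF r] by (intro integrable_mult_right) (auto simp: has_bochner_integral_iff)
  then show ?thesis
    by (rule Bochner_Integration.integrable_bound)
      (auto simp: abs_mult mehler_nonneg intro!: AE_I2 mult_right_mono order_trans[OF B abs_ge_self])
qed

definition OU_op :: "real \<Rightarrow> (real^'d \<Rightarrow> real) \<Rightarrow> real^'d \<Rightarrow> real" where
  "OU_op r f x = (\<integral>y. f y * mehler r x y \<partial>gauss_measure)"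

lemma OU_op_mono:
  assumes "bounded_borel f" "bounded_borel g" "r\<^sup>2 < 1" "\<And>x. f x \<le> g x"
  shows "OU_op r f x \<le> OU_op r g x"
  unfolding OU_op_def
  by (intro integral_mono integrable_mehler_mult assms mult_right_mono mehler_nonneg)

lemma OU_op_const: "r\<^sup>2 < 1 \<Longrightarrow> OU_op r (\<lambda>_. c) x = c"
  using has_bochner_integral_integral_eq[OF mehler_integral[of r x]] by (simp add: OU_op_def)

lemma bounded_borel_const: "bounded_borel (\<lambda>_. c)"
  by (rule bounded_borelI[of _ "\<bar>c\<bar>"]) auto

lemma OU_op_ge: "bounded_borel f \<Longrightarrow> r\<^sup>2 < 1 \<Longrightarrow> (\<And>x. c \<le> f x) \<Longrightarrow> c \<le> OU_op r f x"
  using OU_op_mono[OF bounded_borel_const[of c], of f r x] OU_op_const[of r c x] by simp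

lemma OU_op_le: "bounded_borel f \<Longrightarrow> r\<^sup>2 < 1 \<Longrightarrow> (\<And>x. f x \<le> c) \<Longrightarrow> OU_op r f x \<le> c"
  using OU_op_mono[OF _ bounded_borel_const[of c], of f r x] OU_op_const[of r c x] by simp

lemma bounded_borel_OU_op:
  assumes f: "bounded_borel (f :: real^'d \<Rightarrow> real)" and r: "r\<^sup>2 < 1"
  shows "bounded_borel (OU_op r f)"
proof -
  note [measurable] = bounded_borelD[OF f]
  obtain B where B: "\<And>x. \<bar>f x\<bar> \<le> B" using f by (auto simp: bounded_borel_def)
  have m: "OU_op r f \<in> borel_measurable borel"
    unfolding OU_op_def[abs_def] by (rule gauss.borel_measurable_lebesgue_integral) measurable
  have "- B \<le> OU_op r f x" "OU_op r f x \<le> B" for x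
    using B by (auto intro!: OU_op_ge OU_op_le f r simp: abs_le_iff intro: minus_le_iff[THEN iffD1])
  with m show ?thesis by (intro bounded_borelI[of _ B]) (auto simp: abs_le_iff minus_le_iff)
qed

lemma OU_op_diff_const:
  assumes "bounded_borel f" "r\<^sup>2 < 1"
  shows "OU_op r (\<lambda>x. f x - c) x = OU_op r f x - c"
proof -
  have "OU_op r (\<lambda>x. f x - c) x = OU_op r f x - OU_op r (\<lambda>_. c) x"
    unfolding OU_op_def left_diff_distrib
    by (intro Bochner_Integration.integral_diff integrable_mehler_mult assms bounded_borel_const)
  then show ?thesis by (simp add: OU_op_const assms)
qed

text \<open>Justifies the exchange of integrals both for self-adjointness and for the semigroup law.
  Only integrability is asked of \<open>g\<close>, so that \<open>g\<close> may be a bounded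
  function in the first case and the kernel \<open>mehler r x\<close> in the second.\<close>

lemma integrable_mehler_pair:
  fixes f g :: "real^'d \<Rightarrow> real"
  assumes f: "bounded_borel f" and g: "integrable gauss_measure g" and r: "r\<^sup>2 < 1"
  shows "integrable (gauss_measure \<Otimes>\<^sub>M gauss_measure) (\<lambda>(x, y). g x * (f y * mehler r x y))"
proof -
  note [measurable] = bounded_borelD[OF f]
  have [measurable]: "g \<in> borel_measurable borel"
    using borel_measurable_integrable[OF g] by (simp add: measurable_cong_sets[OF sets_gauss_measure refl])
  obtain B where B: "\<And>x. \<bar>f x\<bar> \<le> B" using f by (auto simp: bounded_borel_def)
  have fa: "bounded_borel (\<lambda>x. \<bar>f x\<bar>)" by (rule bounded_borelI[of _ B]) (use B in auto)
  show ?thesis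
  proof (rule gauss2.Fubini_integrable)
    have "bounded_borel (OU_op r (\<lambda>x. \<bar>f x\<bar>))" by (rule bounded_borel_OU_op[OF fa r])
    then obtain C where C: "\<And>x. \<bar>OU_op r (\<lambda>x. \<bar>f x\<bar>) x\<bar> \<le> C" and [measurable]: "OU_op r (\<lambda>x. \<bar>f x\<bar>) \<in> borel_measurable borel"
      by (auto simp: bounded_borel_def)
    have eq: "(\<integral>y. norm (case (x, y) of (x, y) \<Rightarrow> g x * (f y * mehler r x y)) \<partial>gauss_measure) = \<bar>g x\<bar> * OU_op r (\<lambda>x. \<bar>f x\<bar>) x" for x
      by (simp add: OU_op_def abs_mult mehler_nonneg)
    have "integrable gauss_measure (\<lambda>x. C * \<bar>g x\<bar>)" using g by (intro integrable_mult_right) auto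
    then have "integrable gauss_measure (\<lambda>x. \<bar>g x\<bar> * OU_op r (\<lambda>x. \<bar>f x\<bar>) x)"
      by (rule Bochner_Integration.integrable_bound)
        (auto simp: abs_mult mult.commute[of C] intro!: AE_I2 mult_left_mono order_trans[OF C abs_ge_self])
    then show "integrable gauss_measure (\<lambda>x. \<integral>y. norm (case (x, y) of (x, y) \<Rightarrow> g x * (f y * mehler r x y)) \<partial>gauss_measure)"
      unfolding eq .
    show "AE x in gauss_measure. integrable gauss_measure (\<lambda>y. case (x, y) of (x, y) \<Rightarrow> g x * (f y * mehler r x y))"
      by (auto intro!: AE_I2 integrable_mult_right integrable_mehler_mult f r)
  qed measurable
qed

lemma OU_op_adjoint:
  fixes f g :: "real^'d \<Rightarrow> real"
  assumes f: "bounded_borel f" and g: "bounded_borel g" and r: "r\<^sup>2 < 1"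
  shows "(\<integral>x. OU_op r f x * g x \<partial>gauss_measure) = (\<integral>x. f x * OU_op r g x \<partial>gauss_measure)"
proof -
  have "(\<integral>x. OU_op r f x * g x \<partial>gauss_measure) = (\<integral>x. (\<integral>y. g x * (f y * mehler r x y) \<partial>gauss_measure) \<partial>gauss_measure)"
    by (simp add: OU_op_def mult.commute)
  also have "\<dots> = (\<integral>y. (\<integral>x. g x * (f y * mehler r x y) \<partial>gauss_measure) \<partial>gauss_measure)"
    by (rule gauss2.Fubini_integral[symmetric]) (rule integrable_mehler_pair[OF f bounded_borel_integrable[OF g] r])
  also have "\<dots> = (\<integral>y. f y * OU_op r g y \<partial>gauss_measure)"
    by (simp add: OU_op_def mult.left_commute mehler_sym[of r _ "_::real^'d"] cong: Bochner_Integration.integral_cong)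
  finally show ?thesis .
qed

text \<open>Invariance of the Gaussian measure: self-adjointness tested against the constant
  1.\<close>

lemma integral_OU_op:
  fixes f :: "real^'d \<Rightarrow> real"
  assumes f: "bounded_borel f" and r: "r\<^sup>2 < 1"
  shows "(\<integral>x. OU_op r f x \<partial>gauss_measure) = (\<integral>x. f x \<partial>gauss_measure)"
  using OU_op_adjoint[OF f bounded_borel_const[of 1] r] by (simp add: OU_op_const[OF r])

lemma OU_op_OU_op:
  fixes f :: "real^'d \<Rightarrow> real"
  assumes f: "bounded_borel f" and r: "r\<^sup>2 < 1" and s: "s\<^sup>2 < 1"
  shows "OU_op r (OU_op s f) x = OU_op (r * s) f x"
proof -
  have g: "integrable gauss_measure (mehler r x)"
    using mehler_integral[OF r] by (auto simp: has_bochner_integral_iff)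
  have "OU_op r (OU_op s f) x = (\<integral>z. (\<integral>y. mehler r x z * (f y * mehler s z y) \<partial>gauss_measure) \<partial>gauss_measure)"
    by (simp add: OU_op_def mult.commute)
  also have "\<dots> = (\<integral>y. (\<integral>z. mehler r x z * (f y * mehler s z y) \<partial>gauss_measure) \<partial>gauss_measure)"
    by (rule gauss2.Fubini_integral[symmetric]) (rule integrable_mehler_pair[OF f g s])
  also have "\<dots> = (\<integral>y. f y * (\<integral>z. mehler r x z * mehler s z y \<partial>gauss_measure) \<partial>gauss_measure)"
    by (simp add: mult.left_commute)
  finally show ?thesis by (simp add: mehler_semigroup[OF r s] OU_op_def)
qed

subsection \<open>Contraction on the orthogonal complement of low degree polynomials\<close>

text \<open>Writing \<open>X\<close> as \<theta> times \<open>X / \<theta>\<close> in every term of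
  the tail extracts the factor \<open>\<theta> ^ m\<close>, since \<theta> \<le> 1. Smallness is
  thus paid for by the larger exponent \<open>\<bar>X\<bar> / \<theta>\<close>, uniformly in
  \<open>X\<close>.\<close>

lemma exp_remainder:
  fixes X \<theta> :: real
  assumes \<theta>: "0 < \<theta>" "\<theta> \<le> 1"
  shows "\<bar>exp X - (\<Sum>a<m. X ^ a / fact a)\<bar> \<le> \<theta> ^ m * exp (\<bar>X\<bar> / \<theta>)"
proof -
  have ser: "(\<lambda>a. x ^ a / fact a) sums exp x" for x :: real
    using exp_converges[of x] by (simp add: field_simps)
  let ?u = "\<lambda>a. X ^ (a + m) / fact (a + m)" and ?v = "\<lambda>a. (\<bar>X\<bar> / \<theta>) ^ a / fact a"
  have u: "?u sums (exp X - (\<Sum>a<m. X ^ a / fact a))"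
    using sums_iff_shift[of "\<lambda>a. X ^ a / fact a" m] ser[of X] by simp
  have v: "(\<lambda>a. ?v (a + m)) sums (exp (\<bar>X\<bar> / \<theta>) - (\<Sum>a<m. ?v a))"
    using sums_iff_shift[of ?v m] ser[of "\<bar>X\<bar> / \<theta>"] by simp
  have le: "norm (?u a) \<le> \<theta> ^ m * ?v (a + m)" for a
  proof -
    have "\<bar>X\<bar> ^ (a + m) = \<theta> ^ m * (\<theta> ^ a * (\<bar>X\<bar> / \<theta>) ^ (a + m))"
      using \<theta> by (simp add: power_divide power_add)
    also have "\<dots> \<le> \<theta> ^ m * (1 * (\<bar>X\<bar> / \<theta>) ^ (a + m))"
      using \<theta> by (intro mult_left_mono mult_right_mono power_le_one) auto
    finally show ?thesis by (simp add: power_abs divide_right_mono)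
  qed
  have s: "summable (\<lambda>a. \<theta> ^ m * ?v (a + m))"
    using sums_summable[OF v] by (rule summable_mult)
  have "norm (suminf ?u) \<le> (\<Sum>a. \<theta> ^ m * ?v (a + m))"
    by (rule norm_suminf_le[OF le s])
  also have "\<dots> = \<theta> ^ m * (exp (\<bar>X\<bar> / \<theta>) - (\<Sum>a<m. ?v a))"
    using sums_unique[OF v] suminf_mult[OF sums_summable[OF v]] by simp
  also have "\<dots> \<le> \<theta> ^ m * exp (\<bar>X\<bar> / \<theta>)"
    using \<theta> by (intro mult_left_mono) (auto intro!: sum_nonneg)
  finally show ?thesis using sums_unique[OF u] by simp
qed

text \<open>
  \<open>exp X * exp Y\<close> truncated below degree \<open>n\<close>, where \<open>Y\<close> has degree two: in the Mehler kernel
  \<open>X\<close> is of order \<open>r\<close> and linear in \<open>y\<close>, and \<open>Y\<close> is of order \<open>r\<^sup>2\<close> and quadratic in \<open>y\<close>.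
\<close>

definition exp_trunc :: "nat \<Rightarrow> real \<Rightarrow> real \<Rightarrow> real" where
  "exp_trunc n X Y = (\<Sum>b<(n + 1) div 2. Y ^ b / fact b * (\<Sum>a<n - 2 * b. X ^ a / fact a))"

text \<open>The error is \<open>exp X\<close> times the tail of \<open>exp Y\<close>, plus the
  retained powers of \<open>Y\<close> times tails of \<open>exp X\<close>. Giving \<open>X\<close>
  weight \<theta> and \<open>Y\<close> weight \<open>\<theta>\<^sup>2\<close> makes each of these
  two contributions of order \<open>\<theta> ^ n\<close>, hence the factor 2.\<close>

lemma exp_mult_remainder:
  fixes X Y \<theta> :: real
  assumes \<theta>: "0 < \<theta>" "\<theta> \<le> 1"
  shows "\<bar>exp X * exp Y - exp_trunc n X Y\<bar> \<le> 2 * \<theta> ^ n * exp (\<bar>X\<bar> / \<theta> + \<bar>Y\<bar> / \<theta>\<^sup>2)"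
proof -
  let ?B = "(n + 1) div 2"
  have th2: "0 < \<theta>\<^sup>2" "\<theta>\<^sup>2 \<le> 1" using \<theta> by (auto intro: power_le_one)
  define R where "R m = exp X - (\<Sum>a<m. X ^ a / fact a)" for m
  define S where "S = exp Y - (\<Sum>b<?B. Y ^ b / fact b)"
  have eq: "exp X * exp Y - exp_trunc n X Y = exp X * S + (\<Sum>b<?B. Y ^ b / fact b * R (n - 2 * b))"
    by (simp add: exp_trunc_def R_def S_def right_diff_distrib sum_subtractf sum_distrib_left mult.commute)
  have "\<bar>exp X * S\<bar> \<le> exp (\<bar>X\<bar> / \<theta>) * ((\<theta>\<^sup>2) ^ ?B * exp (\<bar>Y\<bar> / \<theta>\<^sup>2))"
  proof -
    have "\<bar>X\<bar> * \<theta> \<le> \<bar>X\<bar> * 1" using \<theta> by (intro mult_left_mono) auto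
    then have "\<bar>X\<bar> \<le> \<bar>X\<bar> / \<theta>" using \<theta> by (simp add: field_simps)
    then have "X \<le> \<bar>X\<bar> / \<theta>" by linarith
    then show ?thesis unfolding abs_mult S_def using exp_remainder[OF th2, of Y ?B] by (intro mult_mono) auto
  qed
  also have "\<dots> \<le> exp (\<bar>X\<bar> / \<theta>) * (\<theta> ^ n * exp (\<bar>Y\<bar> / \<theta>\<^sup>2))"
  proof -
    \<comment> \<open>Twice \<open>(n + 1) div 2\<close> is at least \<open>n\<close>, and \<theta>
      \<le> 1.\<close>
    have "(\<theta>\<^sup>2) ^ ?B \<le> \<theta> ^ n" unfolding power_mult[symmetric] using \<theta> by (intro power_decreasing) auto
    then show ?thesis by (intro mult_left_mono mult_right_mono) auto
  qed
  finally have 1: "\<bar>exp X * S\<bar> \<le> \<theta> ^ n * exp (\<bar>X\<bar> / \<theta> + \<bar>Y\<bar> / \<theta>\<^sup>2)"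
    by (simp add: exp_add mult_ac)
  have "\<bar>\<Sum>b<?B. Y ^ b / fact b * R (n - 2 * b)\<bar> \<le> (\<Sum>b<?B. \<bar>Y ^ b / fact b * R (n - 2 * b)\<bar>)"
    by (rule sum_abs)
  also have "\<dots> \<le> (\<Sum>b<?B. (\<bar>Y\<bar> / \<theta>\<^sup>2) ^ b / fact b * (\<theta> ^ n * exp (\<bar>X\<bar> / \<theta>)))"
  proof (rule sum_mono)
    fix b assume "b \<in> {..<?B}"
    \<comment> \<open>The indices below \<open>(n + 1) div 2\<close> are exactly those with
      \<open>2 * b < n\<close>, so the subtraction \<open>n - 2 * b\<close> does not
      truncate.\<close>
    then have b: "2 * b < n" by auto
    have "\<bar>Y ^ b / fact b * R (n - 2 * b)\<bar> \<le> \<bar>Y\<bar> ^ b / fact b * (\<theta> ^ (n - 2 * b) * exp (\<bar>X\<bar> / \<theta>))"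
      unfolding abs_mult R_def using exp_remainder[OF \<theta>] by (intro mult_mono) (auto simp: power_abs)
    also have "\<theta> ^ n = \<theta> ^ (n - 2 * b) * (\<theta>\<^sup>2) ^ b"
      unfolding power_mult[symmetric] power_add[symmetric] using b by simp
    then have "\<bar>Y\<bar> ^ b / fact b * (\<theta> ^ (n - 2 * b) * exp (\<bar>X\<bar> / \<theta>)) = (\<bar>Y\<bar> / \<theta>\<^sup>2) ^ b / fact b * (\<theta> ^ n * exp (\<bar>X\<bar> / \<theta>))"
      using \<theta> by (simp add: power_divide)
    finally show "\<bar>Y ^ b / fact b * R (n - 2 * b)\<bar> \<le> (\<bar>Y\<bar> / \<theta>\<^sup>2) ^ b / fact b * (\<theta> ^ n * exp (\<bar>X\<bar> / \<theta>))" .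
  qed
  also have "\<dots> = (\<Sum>b<?B. (\<bar>Y\<bar> / \<theta>\<^sup>2) ^ b / fact b) * (\<theta> ^ n * exp (\<bar>X\<bar> / \<theta>))"
    by (simp add: sum_distrib_right)
  also have "\<dots> \<le> exp (\<bar>Y\<bar> / \<theta>\<^sup>2) * (\<theta> ^ n * exp (\<bar>X\<bar> / \<theta>))"
  proof (intro mult_right_mono)
    have "(\<lambda>a. (\<bar>Y\<bar> / \<theta>\<^sup>2) ^ a / fact a) sums exp (\<bar>Y\<bar> / \<theta>\<^sup>2)"
      using exp_converges[of "\<bar>Y\<bar> / \<theta>\<^sup>2"] by (simp add: field_simps)
    note s = this
    show "(\<Sum>b<?B. (\<bar>Y\<bar> / \<theta>\<^sup>2) ^ b / fact b) \<le> exp (\<bar>Y\<bar> / \<theta>\<^sup>2)"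
      unfolding sums_unique[OF s] by (rule sum_le_suminf[OF sums_summable[OF s]]) auto
  qed (use \<theta> in auto)
  finally have 2: "\<bar>\<Sum>b<?B. Y ^ b / fact b * R (n - 2 * b)\<bar> \<le> \<theta> ^ n * exp (\<bar>X\<bar> / \<theta> + \<bar>Y\<bar> / \<theta>\<^sup>2)"
    by (simp add: exp_add mult_ac)
  show ?thesis unfolding eq using 1 2 abs_triangle_ineq[of "exp X * S" "\<Sum>b<?B. Y ^ b / fact b * R (n - 2 * b)"]
    by linarith
qed

lemma hpoly_exp_trunc:
  fixes b :: "real^'d"
  assumes n: "n \<ge> 1"
  shows "hpoly (n - 1) (\<lambda>y. exp_trunc n (b \<bullet> y) (- c * (norm y)\<^sup>2 / 2))"
  unfolding exp_trunc_def sum_distrib_left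
proof (intro hpoly_sum)
  fix i a assume "i \<in> {..<(n + 1) div 2}" "a \<in> {..<n - 2 * i}"
  then have "a + 2 * i \<le> n - 1" by auto
  then have "hpoly (n - 1) (\<lambda>y. (b \<bullet> y) ^ a * ((norm y)\<^sup>2) ^ i)"
    by (rule hpoly_mono[OF hpoly_inner_norm])
  from hpoly.scale[OF this, of "(- c / 2) ^ i / fact i / fact a"]
  have "hpoly (n - 1) (\<lambda>y. (- c / 2) ^ i / fact i / fact a * ((b \<bullet> y) ^ a * ((norm y)\<^sup>2) ^ i))" .
  moreover have "(- c / 2) ^ i / fact i / fact a * ((b \<bullet> y) ^ a * ((norm y)\<^sup>2) ^ i) =
      (- c * (norm y)\<^sup>2 / 2) ^ i / fact i * ((b \<bullet> y) ^ a / fact a)" for y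
  proof -
    have "- c * (norm y)\<^sup>2 / 2 = (- c / 2) * (norm y)\<^sup>2" by simp
    then have "(- c * (norm y)\<^sup>2 / 2) ^ i = (- c / 2) ^ i * ((norm y)\<^sup>2) ^ i"
      by (simp only: power_mult_distrib)
    then show ?thesis by simp
  qed
  ultimately show "hpoly (n - 1) (\<lambda>y. (- c * (norm y)\<^sup>2 / 2) ^ i / fact i * ((b \<bullet> y) ^ a / fact a))"
    by (simp only:)
qed

text \<open>The part of the expanded kernel of degree below \<open>n\<close> in \<open>y\<close>
  integrates to 0 against \<open>f\<close>, leaving a remainder of order \<open>r ^ n\<close> with a
  Gaussian weight in \<open>x\<close>. That weight is small enough to stay integrable after
  squaring.\<close>

lemma OU_op_decay:
  fixes f :: "real^'d \<Rightarrow> real"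
  assumes f: "bounded_borel f" and n: "n \<ge> 1"
    and orth: "\<And>k. (\<Sum>j\<in>UNIV. k j) < n \<Longrightarrow> (\<integral>x. f x * multi_he k x \<partial>gauss_measure) = 0"
  shows "\<exists>C. \<forall>r. 0 < r \<and> r \<le> 1 / 16 \<longrightarrow> (\<integral>x. (OU_op r f x)\<^sup>2 \<partial>gauss_measure) \<le> C * r ^ (2 * n)"
proof -
  note [measurable] = bounded_borelD[OF f]
  obtain B where B: "\<And>x. \<bar>f x\<bar> \<le> B" using f by (auto simp: bounded_borel_def)
  then have B0: "0 \<le> B" by (meson abs_ge_zero order_trans)
  define J where "J = (\<integral>y. exp (1/8 * (norm (y::real^'d))\<^sup>2) \<partial>gauss_measure)"
  have J0: "J \<ge> 0" unfolding J_def by (rule Bochner_Integration.integral_nonneg) auto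
  define D where "D = (1 / 2) powr (- real CARD('d) / 2) * (2 * 16 ^ n * B * J)"
  have D0: "D \<ge> 0" unfolding D_def using B0 J0 by auto
  have pw: "\<bar>OU_op r f x\<bar> \<le> D * r ^ n * exp (1/16 * (norm x)\<^sup>2)" if r: "0 < r" "r \<le> 1 / 16" for r and x
  proof -
    have "r\<^sup>2 \<le> (1 / 16)\<^sup>2" using r by (intro power_mono) auto
    then have r2: "r\<^sup>2 \<le> 1 / 2" "r\<^sup>2 < 1" by (auto simp: power2_eq_square)
    define p where "p = 1 - r\<^sup>2"
    have p: "p \<ge> 1 / 2" using r2 by (simp add: p_def)
    \<comment> \<open>Since \<open>b\<close> is of order \<open>r\<close> and \<open>c\<close> of
      order \<open>r\<^sup>2\<close>, dividing by \<theta> and \<open>\<theta>\<^sup>2\<close>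
      removes \<open>r\<close> from the exponents. The constant 16 leaves at most one sixteenth of
      the squared norm of \<open>x\<close> and one eighth of that of \<open>y\<close>, and the
      restriction on \<open>r\<close> gives \<theta> \<le> 1.\<close>
    define \<theta> where "\<theta> = 16 * r"
    have \<theta>: "0 < \<theta>" "\<theta> \<le> 1" using r by (auto simp: \<theta>_def)
    define b where "b = (r / p) *\<^sub>R x"
    define c where "c = r\<^sup>2 / p"
    define Q where "Q y = exp_trunc n (b \<bullet> y) (- c * (norm y)\<^sup>2 / 2)" for y :: "real^'d"
    define G where "G y = exp (b \<bullet> y) * exp (- c * (norm y)\<^sup>2 / 2)" for y :: "real^'d"
    define K where "K = p powr (- real CARD('d) / 2) * exp (- r\<^sup>2 * (norm x)\<^sup>2 / (2 * p))"
    have K: "0 \<le> K" "K \<le> (1 / 2) powr (- real CARD('d) / 2)"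
    proof -
      have "K \<le> (1 / 2) powr (- real CARD('d) / 2) * 1"
        unfolding K_def using p by (intro mult_mono powr_mono2') (auto intro!: divide_nonneg_nonneg)
      then show "K \<le> (1 / 2) powr (- real CARD('d) / 2)" by simp
    qed (simp add: K_def)
    have Gc: "exp (b \<bullet> y - c * (norm y)\<^sup>2 / 2) = G y" for y
      by (simp add: G_def exp_add[symmetric])
    have hQ: "hpoly (n - 1) Q" unfolding Q_def[abs_def] by (rule hpoly_exp_trunc[OF n])
    have iQ: "integrable gauss_measure (\<lambda>y. f y * Q y)"
      by (rule integrable_bounded_hpoly[OF _ B hQ]) measurable
    have Q0: "(\<integral>y. f y * Q y \<partial>gauss_measure) = 0"
      by (rule integral_hpoly_eq_0[OF _ B _ hQ]) (use n in \<open>auto intro!: orth\<close>)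
    have c0: "c \<ge> 0" unfolding c_def using p by auto
    have "has_bochner_integral gauss_measure (\<lambda>y. exp (b \<bullet> y - c * (norm y)\<^sup>2 / 2))
        ((1 + c) powr (- real CARD('d) / 2) * exp ((norm b)\<^sup>2 / (2 * (1 + c))))"
      using c0 by (intro gauss_measure_exp) auto
    then have iG0: "integrable gauss_measure G"
      unfolding Gc by (auto simp: has_bochner_integral_iff)
    have iG: "integrable gauss_measure (\<lambda>y. f y * G y)"
    proof (rule Bochner_Integration.integrable_bound[OF integrable_mult_right[OF iG0, of B]])
      show "(\<lambda>y. f y * G y) \<in> borel_measurable gauss_measure" unfolding G_def by measurable
    qed (use B B0 in \<open>auto intro!: AE_I2 mult_right_mono simp: abs_mult G_def\<close>)
    have est: "norm (f y * G y - f y * Q y) \<le> (2 * \<theta> ^ n * B * exp (1/16 * (norm x)\<^sup>2)) * exp (1/8 * (norm y)\<^sup>2)" for y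
    proof -
      have e1: "\<bar>b \<bullet> y\<bar> / \<theta> \<le> 1/16 * (norm x)\<^sup>2 + 1/16 * (norm y)\<^sup>2"
      proof -
        have "\<bar>b \<bullet> y\<bar> / \<theta> = \<bar>x \<bullet> y\<bar> / (16 * p)"
          using r p by (simp add: b_def \<theta>_def abs_mult)
        also have "\<dots> \<le> \<bar>x \<bullet> y\<bar> / 8" using p by (intro divide_left_mono) auto
        also have "\<bar>x \<bullet> y\<bar> \<le> norm x * norm y" by (rule Cauchy_Schwarz_ineq2)
        also have "norm x * norm y \<le> ((norm x)\<^sup>2 + (norm y)\<^sup>2) / 2"
          using sum_squares_bound[of "norm x" "norm y"] by simp
        finally show ?thesis by (simp add: field_simps)
      qed
      have e2: "\<bar>- c * (norm y)\<^sup>2 / 2\<bar> / \<theta>\<^sup>2 \<le> 1/16 * (norm y)\<^sup>2"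
      proof -
        have "\<bar>- c * (norm y)\<^sup>2 / 2\<bar> / \<theta>\<^sup>2 = (norm y)\<^sup>2 / (512 * p)"
          using r p by (simp add: c_def \<theta>_def abs_mult power_mult_distrib)
        also have "\<dots> \<le> (norm y)\<^sup>2 / 16" using p by (intro divide_left_mono) auto
        finally show ?thesis by simp
      qed
      have "\<bar>G y - Q y\<bar> \<le> 2 * \<theta> ^ n * exp (\<bar>b \<bullet> y\<bar> / \<theta> + \<bar>- c * (norm y)\<^sup>2 / 2\<bar> / \<theta>\<^sup>2)"
        unfolding G_def Q_def by (rule exp_mult_remainder[OF \<theta>])
      also have "\<dots> \<le> 2 * \<theta> ^ n * exp (1/16 * (norm x)\<^sup>2 + 1/8 * (norm y)\<^sup>2)"
        using e1 e2 \<theta> by (intro mult_left_mono) auto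
      finally have "\<bar>f y\<bar> * \<bar>G y - Q y\<bar> \<le> B * (2 * \<theta> ^ n * exp (1/16 * (norm x)\<^sup>2 + 1/8 * (norm y)\<^sup>2))"
        by (intro mult_mono B B0) auto
      then show ?thesis
        by (simp add: exp_add mult_ac abs_mult[symmetric] right_diff_distrib)
    qed
    have "OU_op r f x = K * (\<integral>y. f y * G y \<partial>gauss_measure)"
      unfolding OU_op_def mehler_split[OF r2(2)] p_def[symmetric] b_def[symmetric] c_def[symmetric] K_def[symmetric] Gc
      by (simp add: mult.left_commute)
    \<comment> \<open>Orthogonality allows \<open>Q\<close> to be subtracted without changing the
      integral, so only the Taylor remainder has to be estimated.\<close>
    also have "(\<integral>y. f y * G y \<partial>gauss_measure) = (\<integral>y. f y * G y - f y * Q y \<partial>gauss_measure)"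
      using Q0 Bochner_Integration.integral_diff[OF iG iQ] by simp
    finally have "\<bar>OU_op r f x\<bar> = K * \<bar>\<integral>y. f y * G y - f y * Q y \<partial>gauss_measure\<bar>"
      using K(1) by (simp add: abs_mult)
    also have "\<dots> \<le> (1 / 2) powr (- real CARD('d) / 2) * ((2 * \<theta> ^ n * B * exp (1/16 * (norm x)\<^sup>2)) * J)"
    proof (intro mult_mono K)
      have iE: "integrable gauss_measure (\<lambda>y::real^'d. exp (1/8 * (norm y)\<^sup>2))"
        by (rule integrable_exp_norm) simp
      have "norm (\<integral>y. f y * G y - f y * Q y \<partial>gauss_measure) \<le> (\<integral>y. (2 * \<theta> ^ n * B * exp (1/16 * (norm x)\<^sup>2)) * exp (1/8 * (norm (y::real^'d))\<^sup>2) \<partial>gauss_measure)"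
        by (intro order_trans[OF integral_norm_bound] integral_mono integrable_norm est
          integrable_mult_right iE Bochner_Integration.integrable_diff iG iQ)
      then show "\<bar>\<integral>y. f y * G y - f y * Q y \<partial>gauss_measure\<bar> \<le> (2 * \<theta> ^ n * B * exp (1/16 * (norm x)\<^sup>2)) * J"
        by (simp add: J_def)
    qed auto
    also have "\<dots> = D * r ^ n * exp (1/16 * (norm x)\<^sup>2)"
      by (simp add: D_def \<theta>_def power_mult_distrib)
    finally show ?thesis .
  qed
  have "(\<integral>x. (OU_op r f x)\<^sup>2 \<partial>gauss_measure) \<le> (D\<^sup>2 * J) * r ^ (2 * n)" if r: "0 < r" "r \<le> 1 / 16" for r
  proof -
    have "r\<^sup>2 \<le> (1 / 16)\<^sup>2" using r by (intro power_mono) auto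
    then have r2: "r\<^sup>2 < 1" by (auto simp: power2_eq_square)
    have sq: "(OU_op r f x)\<^sup>2 \<le> (D\<^sup>2 * r ^ (2 * n)) * exp (1/8 * (norm x)\<^sup>2)" for x
    proof -
      have "\<bar>OU_op r f x\<bar>\<^sup>2 \<le> (D * r ^ n * exp (1/16 * (norm x)\<^sup>2))\<^sup>2"
        by (intro power_mono pw r) auto
      also have "\<dots> = (D\<^sup>2 * r ^ (2 * n)) * exp (1/8 * (norm x)\<^sup>2)"
        by (simp add: power_mult_distrib exp_double[symmetric] power_mult[symmetric] mult.commute)
      finally show ?thesis by simp
    qed
    have "(\<integral>x. (OU_op r f x)\<^sup>2 \<partial>gauss_measure) \<le> (\<integral>x. (D\<^sup>2 * r ^ (2 * n)) * exp (1/8 * (norm (x::real^'d))\<^sup>2) \<partial>gauss_measure)"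
      by (intro integral_mono sq bounded_borel_integrable bounded_borel_square bounded_borel_OU_op f r2
          integrable_mult_right integrable_exp_norm) auto
    then show ?thesis by (simp add: J_def mult_ac)
  qed
  then show ?thesis by blast
qed

section \<open>From asymptotic decay to contraction in each step\<close>

text \<open>Ratios of consecutive terms of a log-convex sequence do not decrease. One ratio \<rho>
  above \<open>q\<close> would therefore force growth like \<open>\<rho> ^ i\<close> from there on,
  which outgrows \<open>C * q ^ j\<close> for any constant \<open>C\<close>.\<close>

lemma log_convex_seq_ratio:
  fixes a :: "nat \<Rightarrow> real"
  assumes a0: "\<And>j. 0 \<le> a j" and conv: "\<And>j. (a (Suc j))\<^sup>2 \<le> a j * a (Suc (Suc j))"
    and q: "0 < q" and bound: "eventually (\<lambda>j. a j \<le> C * q ^ j) sequentially"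
  shows "a (Suc j) \<le> q * a j"
proof (rule ccontr)
  assume "\<not> ?thesis"
  then have gt: "a (Suc j) > q * a j" by simp
  \<comment> \<open>If \<open>a j\<close> vanished, convexity would make \<open>a (Suc j)\<close>
    vanish as well, against the strict inequality \<open>gt\<close>.\<close>
  have aj: "a j > 0"
  proof (rule ccontr)
    assume "\<not> ?thesis"
    then have "a j = 0" using a0[of j] by simp
    then show False using conv[of j] gt by simp
  qed
  define \<rho> where "\<rho> = a (Suc j) / a j"
  have \<rho>: "\<rho> > q" using gt aj by (simp add: \<rho>_def field_simps)
  have step: "a (j + i) > 0 \<and> a (Suc (j + i)) \<ge> \<rho> * a (j + i)" for i
  proof (induction i)
    case 0
    then show ?case using aj by (simp add: \<rho>_def)
  next
    case (Suc i)
    have pos: "a (Suc (j + i)) > 0" using Suc \<rho> q by (smt (verit) mult_pos_pos)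
    have "\<rho> * a (j + i) * a (Suc (j + i)) \<le> (a (Suc (j + i)))\<^sup>2"
      unfolding power2_eq_square using Suc pos by (intro mult_right_mono) auto
    also have "\<dots> \<le> a (j + i) * a (Suc (Suc (j + i)))" by (rule conv)
    finally have "a (j + i) * (\<rho> * a (Suc (j + i))) \<le> a (j + i) * a (Suc (Suc (j + i)))" by (simp add: mult_ac)
    then show ?case using Suc pos by simp
  qed
  have lower: "\<rho> ^ i * a j \<le> a (i + j)" for i
  proof (induction i)
    case (Suc i)
    have "\<rho> ^ Suc i * a j \<le> \<rho> * a (i + j)" using Suc \<rho> q by (simp add: mult.assoc)
    also have "\<dots> \<le> a (Suc i + j)" using step[of i] by (simp add: add.commute)
    finally show ?case .
  qed simp
  have "eventually (\<lambda>i. a (i + j) \<le> C * q ^ (i + j)) sequentially"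
    using bound eventually_sequentially_seg[of "\<lambda>j. a j \<le> C * q ^ j" j] by simp
  then have "eventually (\<lambda>i. a j \<le> C * q ^ j * (q / \<rho>) ^ i) sequentially"
  proof eventually_elim
    case (elim i)
    have p: "\<rho> ^ i > 0" using \<rho> q by simp
    have "\<rho> ^ i * a j \<le> C * q ^ j * q ^ i" using lower[of i] elim by (simp add: power_add mult_ac)
    then show ?case using p by (simp add: power_divide field_simps)
  qed
  moreover have "(\<lambda>i. C * q ^ j * (q / \<rho>) ^ i) \<longlonglongrightarrow> C * q ^ j * 0"
    using \<rho> q by (intro tendsto_mult_left LIMSEQ_realpow_zero) auto
  ultimately have "a j \<le> C * q ^ j * 0"
    by (intro tendsto_lowerbound[of _ _ sequentially]) auto
  then show False using aj by simp
qed

lemma Cauchy_Schwarz_integral: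
  fixes f g :: "'a \<Rightarrow> real"
  assumes f: "integrable M (\<lambda>x. (f x)\<^sup>2)" and g: "integrable M (\<lambda>x. (g x)\<^sup>2)"
    and fg: "integrable M (\<lambda>x. f x * g x)"
  shows "(\<integral>x. f x * g x \<partial>M)\<^sup>2 \<le> (\<integral>x. (f x)\<^sup>2 \<partial>M) * (\<integral>x. (g x)\<^sup>2 \<partial>M)"
proof -
  let ?F = "\<integral>x. (f x)\<^sup>2 \<partial>M" and ?G = "\<integral>x. (g x)\<^sup>2 \<partial>M" and ?P = "\<integral>x. f x * g x \<partial>M"
  have quad: "0 \<le> s\<^sup>2 * ?F - 2 * s * t * ?P + t\<^sup>2 * ?G" for s t
  proof -
    have "0 \<le> (\<integral>x. (s * f x - t * g x)\<^sup>2 \<partial>M)" by simp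
    also have "(\<lambda>x. (s * f x - t * g x)\<^sup>2) = (\<lambda>x. s\<^sup>2 * (f x)\<^sup>2 - 2 * s * t * (f x * g x) + t\<^sup>2 * (g x)\<^sup>2)"
      by (simp add: power2_eq_square algebra_simps)
    finally show ?thesis using f g fg by simp
  qed
  show ?thesis
  proof (cases "?G = 0")
    case True
    have "?P = 0"
    proof (rule ccontr)
      assume P: "?P \<noteq> 0"
      \<comment> \<open>With \<open>?G = 0\<close> the form is affine in \<open>t\<close>, and this
        \<open>t\<close> gives it the value -1.\<close>
      show False using quad[of 1 "(?F + 1) / (2 * ?P)"] True P by (simp add: field_simps)
    qed
    then show ?thesis using True by simp
  next
    case False
    then have G: "?G > 0" by (simp add: less_le)
    have "0 \<le> ?G * (?F * ?G - ?P\<^sup>2)"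
      using quad[of ?G ?P] by (simp add: power2_eq_square algebra_simps)
    then show ?thesis using G by (simp add: zero_le_mult_iff)
  qed
qed

lemma bounded_borel_OU_iter:
  "bounded_borel f \<Longrightarrow> r\<^sup>2 < 1 \<Longrightarrow> bounded_borel ((OU_op r ^^ j) f)"
  by (induction j) (auto intro: bounded_borel_OU_op)

lemma power2_less_one: "0 < r \<Longrightarrow> r < 1 \<Longrightarrow> (r::real)\<^sup>2 < 1"
  by (simp add: power_less_one_iff)

text \<open>The count starts at one step: the zeroth iterate is \<open>f\<close> itself, whereas the
  kernel degenerates at \<open>r = 1\<close>.\<close>

lemma OU_iter:
  assumes f: "bounded_borel f" and r: "0 < r" "r < 1"
  shows "(OU_op r ^^ Suc j) f = OU_op (r ^ Suc j) f"
proof (induction j)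
  case (Suc j)
  have "(OU_op r ^^ Suc (Suc j)) f = OU_op r (OU_op (r ^ Suc j) f)"
    using Suc by simp
  also have "\<dots> = OU_op (r * r ^ Suc j) f"
    using r by (intro ext OU_op_OU_op f power2_less_one) (auto intro: power_less_one_iff[THEN iffD2] simp del: power_Suc)
  finally show ?case by simp
qed simp

text \<open>Self-adjointness writes the squared norm of iterate \<open>j + 1\<close> as the inner
  product of iterates \<open>j\<close> and \<open>j + 2\<close>, so Cauchy-Schwarz gives
  log-convexity. Iterate \<open>j\<close> is the operator of parameter \<open>r ^ j\<close>, to
  which \<open>OU_op_decay\<close> applies for large \<open>j\<close>. Treating all \<open>j\<close>
  at once requires orthogonality of \<open>f\<close> only, not of its iterates.\<close>

lemma OU_iter_contraction:
  fixes f :: "real^'d \<Rightarrow> real"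
  assumes f: "bounded_borel f" and r: "0 < r" "r < 1" and n: "n \<ge> 1"
    and orth: "\<And>k. (\<Sum>j\<in>UNIV. k j) < n \<Longrightarrow> (\<integral>x. f x * multi_he k x \<partial>gauss_measure) = 0"
  shows "(\<integral>x. ((OU_op r ^^ Suc j) f x)\<^sup>2 \<partial>gauss_measure)
    \<le> r ^ (2 * n) * (\<integral>x. ((OU_op r ^^ j) f x)\<^sup>2 \<partial>gauss_measure)"
proof -
  note r2 = power2_less_one[OF r]
  define F where "F j = (OU_op r ^^ j) f" for j
  have F: "bounded_borel (F j)" for j unfolding F_def by (rule bounded_borel_OU_iter[OF f r2])
  have FS: "F (Suc j) = OU_op r (F j)" for j by (simp add: F_def)
  define a where "a j = (\<integral>x. (F j x)\<^sup>2 \<partial>gauss_measure)" for j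
  obtain C where C: "\<And>r. 0 < r \<Longrightarrow> r \<le> 1 / 16 \<Longrightarrow> (\<integral>x. (OU_op r f x)\<^sup>2 \<partial>gauss_measure) \<le> C * r ^ (2 * n)"
    using OU_op_decay[OF f n orth] by blast
  have "a (Suc j) \<le> r ^ (2 * n) * a j"
  proof (rule log_convex_seq_ratio)
    fix j
    show "0 \<le> a j" by (simp add: a_def)
    have "a (Suc j) = (\<integral>x. F j x * F (Suc (Suc j)) x \<partial>gauss_measure)"
      using OU_op_adjoint[OF F[of j] F[of "Suc j"] r2] by (simp add: a_def power2_eq_square FS)
    then show "(a (Suc j))\<^sup>2 \<le> a j * a (Suc (Suc j))"
      unfolding a_def
      by (simp only:) (intro Cauchy_Schwarz_integral bounded_borel_integrable bounded_borel_square bounded_borel_mult F)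
  next
    have "(\<lambda>j. r ^ j) \<longlonglongrightarrow> 0" using r by (intro LIMSEQ_realpow_zero) auto
    then have "eventually (\<lambda>j. r ^ j < 1 / 16) sequentially"
      by (rule order_tendstoD) simp
    then have "eventually (\<lambda>j. r ^ j < 1 / 16 \<and> j \<ge> 1) sequentially"
      using eventually_ge_at_top by (rule eventually_conj)
    then show "eventually (\<lambda>j. a j \<le> C * (r ^ (2 * n)) ^ j) sequentially"
    proof eventually_elim
      case (elim j)
      then obtain i where i: "j = Suc i" by (cases j) auto
      have "a j \<le> C * (r ^ j) ^ (2 * n)"
        unfolding a_def F_def i OU_iter[OF f r] using elim r unfolding i by (intro C) (auto simp del: power_Suc)
      then show ?case by (simp add: power_mult[symmetric] mult.commute)
    qed
  qed (use r in auto)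
  then show ?thesis by (simp add: a_def F_def)
qed

subsection \<open>Entropy\<close>

lemma xlnx_tangent:
  fixes s u M :: real
  assumes s: "0 \<le> s" "s \<le> M" and u: "0 < u" "u \<le> M"
  shows "u * ln u + (ln u + 1) * (s - u) + (s - u)\<^sup>2 / (2 * M) \<le> s * ln s"
proof (cases "s = 0")
  case True
  have "u\<^sup>2 / (2 * M) \<le> u"
    using u by (simp add: power2_eq_square field_simps)
  then show ?thesis using True by (simp add: algebra_simps)
next
  case False
  then have s0: "s > 0" using s by simp
  have M: "M > 0" using u by simp
  define D where "D v = v * ln v - (ln u + 1) * v - (v - u)\<^sup>2 / (2 * M)" for v
  have D': "(D has_real_derivative (ln v - ln u - (v - u) / M)) (at v)" if "v > 0" for v
    unfolding D_def using that M by (auto intro!: derivative_eq_intros simp: field_simps)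
  have "D u \<le> D s"
  proof (cases "u \<le> s")
    case True
    show ?thesis
    proof (rule DERIV_nonneg_imp_nondecreasing[OF True])
      fix v assume v: "u \<le> v" "v \<le> s"
      have "ln (u / v) \<le> u / v - 1" using v u by (intro ln_le_minus_one) auto
      then have "1 - u / v \<le> ln v - ln u" using v u by (simp add: ln_div)
      moreover have "(v - u) / M \<le> (v - u) / v" using v u s by (intro divide_left_mono) auto
      moreover have "(v - u) / v = 1 - u / v" using v u by (simp add: diff_divide_distrib)
      ultimately have "0 \<le> ln v - ln u - (v - u) / M" by linarith
      then show "\<exists>y. (D has_real_derivative y) (at v) \<and> 0 \<le> y" using D'[of v] v u by auto
    qed
  next
    case False
    then have "s \<le> u" by simp
    then show ?thesis
    proof (rule DERIV_nonpos_imp_nonincreasing)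
      fix v assume v: "s \<le> v" "v \<le> u"
      have "ln (v / u) \<le> v / u - 1" using v u s0 by (intro ln_le_minus_one) auto
      then have "1 - v / u \<le> ln u - ln v" using v u s0 by (simp add: ln_div)
      moreover have "(u - v) / M \<le> (u - v) / u" using v u by (intro divide_left_mono) auto
      moreover have "(u - v) / u = 1 - v / u" using u by (simp add: diff_divide_distrib)
      moreover have "(v - u) / M = - ((u - v) / M)" by (simp add: minus_divide_left)
      ultimately have "ln v - ln u - (v - u) / M \<le> 0" by linarith
      then show "\<exists>y. (D has_real_derivative y) (at v) \<and> y \<le> 0" using D'[of v] v s0 by auto
    qed
  qed
  then show ?thesis by (simp add: D_def algebra_simps)
qed

text \<open>The quotient \<open>2 * (s - 1) / (s + 1)\<close> is the first Pade approximant of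
  \<open>ln\<close> at 1. The difference \<open>D\<close> vanishes at 1 and is nondecreasing. These
  bounds determine the sign of the derivative of \<open>aux_h1\<close>.\<close>

lemma ln_Pade_bound:
  fixes s :: real
  assumes "s > 0"
  shows "1 \<le> s \<Longrightarrow> 2 * (s - 1) \<le> (s + 1) * ln s" and "s \<le> 1 \<Longrightarrow> (s + 1) * ln s \<le> 2 * (s - 1)"
proof -
  define D where "D v = ln v - 2 * (v - 1) / (v + 1)" for v :: real
  have D': "(D has_real_derivative (v - 1)\<^sup>2 / (v * (v + 1)\<^sup>2)) (at v)" if v: "v > 0" for v
  proof -
    have "(D has_real_derivative (1 / v - (2 * (v + 1) - 2 * (v - 1)) / ((v + 1) * (v + 1)))) (at v)"
      unfolding D_def using v by (auto intro!: derivative_eq_intros simp: field_simps)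
    moreover have "1 / v - (2 * (v + 1) - 2 * (v - 1)) / ((v + 1) * (v + 1)) = (v - 1)\<^sup>2 / (v * (v + 1)\<^sup>2)"
      using v by (simp add: divide_simps) (simp add: power2_eq_square algebra_simps)
    ultimately show ?thesis by simp
  qed
  have mono: "D a \<le> D b" if "0 < a" "a \<le> b" for a b
    using that(2)
  proof (rule DERIV_nonneg_imp_nondecreasing)
    fix v assume "a \<le> v" "v \<le> b"
    then have "v > 0" using that by simp
    moreover from this have "0 \<le> (v - 1)\<^sup>2 / (v * (v + 1)\<^sup>2)" by simp
    ultimately show "\<exists>y. (D has_real_derivative y) (at v) \<and> 0 \<le> y" using D' by blast
  qed
  have D1: "D 1 = 0" by (simp add: D_def)
  show "2 * (s - 1) \<le> (s + 1) * ln s" if "1 \<le> s"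
    using mono[of 1 s] that D1 assms by (simp add: D_def field_simps)
  show "(s + 1) * ln s \<le> 2 * (s - 1)" if "s \<le> 1"
    using mono[of s 1] that D1 assms by (simp add: D_def field_simps)
qed

lemma xlnx_le: "0 \<le> (s::real) \<Longrightarrow> s * ln s \<le> s * (s - 1)"
  by (cases "s = 0") (auto intro!: mult_left_mono ln_le_minus_one)

lemma xlnx_ge:
  assumes "0 \<le> (s::real)"
  shows "s - 1 \<le> s * ln s"
proof (cases "s = 0")
  case False
  then have "ln (1 / s) \<le> 1 / s - 1" using assms by (intro ln_le_minus_one) auto
  then show ?thesis using False assms by (simp add: ln_div field_simps)
qed simp

lemma xlnx_gt:
  assumes "0 \<le> (s::real)" "s \<noteq> 1"
  shows "s - 1 < s * ln s"
proof (cases "s = 0")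
  case False
  then have "ln (1 / s) \<le> 1 / s - 1" using assms by (intro ln_le_minus_one) auto
  moreover have "ln (1 / s) \<noteq> 1 / s - 1" using ln_eq_minus_one[of "1 / s"] False assms by auto
  ultimately have "ln (1 / s) < 1 / s - 1" by simp
  then show ?thesis using False assms by (simp add: ln_div field_simps)
qed simp

text \<open>This form without division also covers the exceptional values 0 and 1.\<close>

lemma aux_h1_eq: "0 \<le> s \<Longrightarrow> s * ln s - (s - 1) = aux_h1 s * (s - 1)\<^sup>2"
  by (auto simp: aux_h1_def)

lemma aux_h1_pos: "0 \<le> s \<Longrightarrow> 0 < aux_h1 s"
  using xlnx_gt[of s] by (auto simp: aux_h1_def intro!: divide_pos_pos)

lemma aux_h1_le_1: "0 \<le> s \<Longrightarrow> aux_h1 s \<le> 1"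
proof -
  assume s: "0 \<le> s"
  have "s * ln s - (s - 1) \<le> 1 * (s - 1)\<^sup>2"
    using xlnx_le[OF s] by (simp add: power2_eq_square algebra_simps)
  then show ?thesis
    unfolding aux_h1_eq[OF s] by (cases "s = 1") (auto simp: aux_h1_def mult_le_cancel_right)
qed

lemma aux_h1_measurable[measurable]: "aux_h1 \<in> borel_measurable borel"
  unfolding aux_h1_def[abs_def] by measurable

text \<open>Comparison with the value 1/2 at \<open>s = 1\<close> joins the two branches of
  \<open>aux_h1\<close> where its quotient is singular, with no appeal to continuity there.\<close>

lemma aux_h1_half:
  fixes s :: real
  shows "0 < s \<Longrightarrow> s \<le> 1 \<Longrightarrow> 1 / 2 \<le> aux_h1 s" and "1 \<le> s \<Longrightarrow> aux_h1 s \<le> 1 / 2"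
proof -
  define D where "D v = v * ln v - (v - 1) - (v - 1)\<^sup>2 / 2" for v :: real
  have D': "(D has_real_derivative (ln v - (v - 1))) (at v)" if v: "v > 0" for v
  proof -
    have "((\<lambda>v. v * ln v - (v - 1) - (v - 1)\<^sup>2 / 2) has_real_derivative
        ((1 * ln v + 1 / v * v) - 1 - 2 * (v - 1) / 2)) (at v)"
      using v by (auto intro!: derivative_eq_intros)
    moreover have "(1 * ln v + 1 / v * v) - 1 - 2 * (v - 1) / 2 = ln v - (v - 1)" using v by (simp add: field_simps)
    ultimately show ?thesis by (simp only: D_def[abs_def])
  qed
  have mono: "D b \<le> D a" if "0 < a" "a \<le> b" for a b
    using that(2)
  proof (rule DERIV_nonpos_imp_nonincreasing)
    fix v assume "a \<le> v" "v \<le> b"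
    then show "\<exists>y. (D has_real_derivative y) (at v) \<and> y \<le> 0"
      using that D'[of v] ln_le_minus_one[of v] by auto
  qed
  have D1: "D 1 = 0" by (simp add: D_def)
  show "1 / 2 \<le> aux_h1 s" if "0 < s" "s \<le> 1"
  proof (cases "s = 1")
    case False
    then show ?thesis using mono[of s 1] that D1
      by (simp add: D_def aux_h1_def field_simps power2_commute[of 1 s])
  qed (simp add: aux_h1_def)
  show "aux_h1 s \<le> 1 / 2" if "1 \<le> s"
  proof (cases "s = 1")
    case False
    then show ?thesis using mono[of 1 s] that D1 by (simp add: D_def aux_h1_def field_simps)
  qed (simp add: aux_h1_def)
qed

text \<open>The derivative is used only on intervals that avoid 1. Passing across 1 goes through the
  value 1/2, and \<open>s = 0\<close> through the upper bound 1.\<close>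

lemma aux_h1_antimono:
  assumes st: "0 \<le> s" "s \<le> t"
  shows "aux_h1 t \<le> aux_h1 s"
proof -
  define h where "h v = (v * ln v - (v - 1)) / (v - 1)\<^sup>2" for v :: real
  have h: "aux_h1 v = h v" if "0 < v" "v \<noteq> 1" for v using that by (simp add: aux_h1_def h_def)
  have h': "(h has_real_derivative (2 * (v - 1) - (v + 1) * ln v) / (v - 1) ^ 3) (at v)"
    if v: "v > 0" "v \<noteq> 1" for v
  proof -
    have "(h has_real_derivative (ln v * (v - 1)\<^sup>2 - (v * ln v - (v - 1)) * (2 * (v - 1))) / ((v - 1)\<^sup>2 * (v - 1)\<^sup>2)) (at v)"
      unfolding h_def using v by (auto intro!: derivative_eq_intros)
    moreover have "(ln v * (v - 1)\<^sup>2 - (v * ln v - (v - 1)) * (2 * (v - 1))) / ((v - 1)\<^sup>2 * (v - 1)\<^sup>2)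
       = ((v - 1) * (2 * (v - 1) - (v + 1) * ln v)) / ((v - 1) * (v - 1) ^ 3)"
      by (rule arg_cong2[of _ _ _ _ "(/)"]) (simp_all add: power2_eq_square power3_eq_cube algebra_simps)
    ultimately show ?thesis using v by simp
  qed
  have h'_le: "(2 * (v - 1) - (v + 1) * ln v) / (v - 1) ^ 3 \<le> 0" if v: "v > 0" "v \<noteq> 1" for v :: real
  proof (cases "v < 1")
    case True
    then have "(v - 1) ^ 3 \<le> 0" by (simp add: power_le_zero_eq)
    then show ?thesis using ln_Pade_bound(2)[of v] v True by (intro divide_nonneg_nonpos) auto
  next
    case False
    then have "(v - 1) ^ 3 \<ge> 0" by simp
    then show ?thesis using ln_Pade_bound(1)[of v] v False by (intro divide_nonpos_nonneg) auto
  qed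
  have mono: "h b \<le> h a" if "0 < a" "a \<le> b" "\<And>v. a \<le> v \<Longrightarrow> v \<le> b \<Longrightarrow> v \<noteq> 1" for a b
    using that(2)
  proof (rule DERIV_nonpos_imp_nonincreasing)
    fix v assume v: "a \<le> v" "v \<le> b"
    then have "v > 0" "v \<noteq> 1" using that by auto
    then show "\<exists>y. (h has_real_derivative y) (at v) \<and> y \<le> 0"
      using h' h'_le by blast
  qed
  consider "s = 0" | "0 < s" "s \<le> 1" "1 \<le> t" | "0 < s" "t < 1" | "1 < s"
    using st by linarith
  then show ?thesis
  proof cases
    case 1
    then show ?thesis using aux_h1_le_1[of t] st by (simp add: aux_h1_def)
  next
    case 2
    then show ?thesis using aux_h1_half(1)[of s] aux_h1_half(2)[of t] by linarith
  next
    case 3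
    then show ?thesis using mono[of s t] h[of s] h[of t] st by force
  next
    case 4
    then show ?thesis using mono[of s t] h[of s] h[of t] st by force
  qed
qed

section \<open>Entropy along the semigroup\<close>

text \<open>The kernel is strictly positive, so a vanishing average at a single point already
  determines \<open>f\<close> almost everywhere. This yields positivity of averages and excludes an
  average lying strictly below almost all values.\<close>

lemma mehler_integral_zero_imp_AE:
  assumes f: "bounded_borel f" and r: "r\<^sup>2 < 1" and nn: "AE y in gauss_measure. 0 \<le> f y"
    and zero: "OU_op r f x = 0"
  shows "AE y in gauss_measure. f y = 0"
proof -
  have "AE y in gauss_measure. 0 \<le> f y * mehler r x y"
    using nn by eventually_elim (simp add: mehler_nonneg)
  then have "AE y in gauss_measure. f y * mehler r x y = 0"
    using integral_nonneg_eq_0_iff_AE[OF integrable_mehler_mult[OF f r]] zero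
    by (simp add: OU_op_def)
  then show ?thesis
    by eventually_elim (use mehler_pos[OF r, of x] in \<open>auto simp: less_le\<close>)
qed

text \<open>As \<open>aux_h1\<close> is decreasing, the bound \<open>K\<close> is a lower bound on
  \<open>w\<close> in disguise, and averages respect lower bounds. Arguing by contradiction avoids
  inverting \<open>aux_h1\<close>: if the bound failed at the average, \<open>w\<close> would exceed
  its own average almost everywhere.\<close>

lemma OU_op_aux_h1_le:
  fixes w :: "real^'d \<Rightarrow> real"
  assumes w: "bounded_borel w" and nn: "\<And>x. 0 \<le> w x" and r: "r\<^sup>2 < 1"
    and K: "AE x in gauss_measure. aux_h1 (w x) \<le> K"
  shows "aux_h1 (OU_op r w x) \<le> K"
proof (rule ccontr)
  assume *: "\<not> ?thesis"
  let ?s = "OU_op r w x"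
  have s: "0 \<le> ?s" by (intro OU_op_ge w r nn)
  have gt: "AE y in gauss_measure. ?s < w y"
    using K
  proof eventually_elim
    case (elim y)
    show ?case
    proof (rule ccontr)
      assume "\<not> ?thesis"
      then have "aux_h1 ?s \<le> aux_h1 (w y)" using nn by (intro aux_h1_antimono) auto
      then show False using elim * by simp
    qed
  qed
  have "AE y in gauss_measure. w y - ?s = 0"
  proof (rule mehler_integral_zero_imp_AE)
    show "AE y in gauss_measure. 0 \<le> w y - ?s" using gt by eventually_elim simp
    show "OU_op r (\<lambda>y. w y - ?s) x = 0" by (simp add: OU_op_diff_const w r)
  qed (auto intro!: bounded_borel_minus_const w r)
  then have "AE y in (gauss_measure :: (real^'d) measure). False" using gt by eventually_elim simp
  then show False by simp
qed

lemma bounded_borel_xlnx: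
  fixes w :: "real^'d \<Rightarrow> real"
  assumes w: "bounded_borel w" and nn: "\<And>x. 0 \<le> w x"
  shows "bounded_borel (\<lambda>x. w x * ln (w x))"
proof -
  note [measurable] = bounded_borelD[OF w]
  obtain B where B: "\<And>x. \<bar>w x\<bar> \<le> B" using w by (auto simp: bounded_borel_def)
  have "\<bar>w x * ln (w x)\<bar> \<le> 1 + B\<^sup>2" for x
  proof -
    have "w x * w x \<le> B * B" using B[of x] nn[of x] by (intro mult_mono) auto
    then show ?thesis
      using xlnx_le[OF nn, of x] xlnx_ge[OF nn, of x] nn[of x]
      by (simp add: abs_le_iff power2_eq_square algebra_simps) (smt (verit) zero_le_square)
  qed
  then show ?thesis by (rule bounded_borelI[rotated]) measurable
qed

lemma OU_op_quadratic:
  assumes f: "bounded_borel f" and r: "r\<^sup>2 < 1"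
  shows "OU_op r (\<lambda>y. a + b * f y + c * (f y)\<^sup>2) x = a + b * OU_op r f x + c * OU_op r (\<lambda>y. (f y)\<^sup>2) x"
proof -
  note i = integrable_mehler_mult[OF _ r]
  have 0: "(\<integral>y. mehler r x y \<partial>gauss_measure) = 1" "integrable gauss_measure (mehler r x)"
    using mehler_integral[OF r, of x] by (auto simp: has_bochner_integral_iff)
  have "OU_op r (\<lambda>y. a + b * f y + c * (f y)\<^sup>2) x
    = (\<integral>y. a * mehler r x y + b * (f y * mehler r x y) + c * ((f y)\<^sup>2 * mehler r x y) \<partial>gauss_measure)"
    unfolding OU_op_def by (simp add: algebra_simps)
  also have "\<dots> = a + b * OU_op r f x + c * OU_op r (\<lambda>y. (f y)\<^sup>2) x"
    using 0 i[OF f, of x] i[OF bounded_borel_square[OF f], of x] by (simp add: OU_op_def)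
  finally show ?thesis .
qed

text \<open>Jensen's inequality for \<open>s ln s - s\<^sup>2 / (2 M)\<close>, which is convex on \<open>[0, M]\<close>.\<close>

lemma entropy_OU_op:
  fixes w :: "real^'d \<Rightarrow> real"
  assumes w: "bounded_borel w" and nn: "\<And>x. 0 \<le> w x" and M: "\<And>x. w x \<le> M"
    and mass: "(\<integral>x. w x \<partial>gauss_measure) \<noteq> 0" and r: "r\<^sup>2 < 1"
  shows "entropy1 (OU_op r w) \<le> entropy1 w -
    ((\<integral>x. (w x)\<^sup>2 \<partial>gauss_measure) - (\<integral>x. (OU_op r w x)\<^sup>2 \<partial>gauss_measure)) / (2 * M)"
proof -
  let ?u = "OU_op r w" and ?e = "\<lambda>x. w x * ln (w x)" and ?sq = "\<lambda>x. (w x)\<^sup>2"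
  have u: "bounded_borel ?u" by (rule bounded_borel_OU_op[OF w r])
  have e: "bounded_borel ?e" by (rule bounded_borel_xlnx[OF w nn])
  have u0: "0 \<le> ?u x" "?u x \<le> M" for x by (auto intro!: OU_op_ge OU_op_le w r nn M)
  \<comment> \<open>The function \<open>s ln s\<close> has a tangent line only at positive points;
    the nonzero mass rules out a zero average.\<close>
  have up: "0 < ?u x" for x
  proof (rule ccontr)
    assume "\<not> ?thesis"
    then have "?u x = 0" using u0[of x] by simp
    then have "AE y in gauss_measure. w y = 0"
      by (intro mehler_integral_zero_imp_AE[OF w r]) (auto simp: nn)
    then have "(\<integral>x. w x \<partial>gauss_measure) = 0" by (rule integral_eq_zero_AE)
    then show False using mass by simp
  qed
  have pw: "?u x * ln (?u x) + (OU_op r ?sq x - (?u x)\<^sup>2) / (2 * M) \<le> OU_op r ?e x" for x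
  proof -
    define s where "s = ?u x"
    have Mp: "M > 0" using up[of x] u0[of x] by simp
    \<comment> \<open>The coefficients of the lower bound in \<open>xlnx_tangent\<close>, expanded
      in powers of \<open>w y\<close>, for the base point \<open>s\<close>. Since \<open>s\<close>
      is the average of \<open>w\<close>, the linear term cancels after averaging and the quadratic
      one becomes a variance.\<close>
    define a b c where "a = s * ln s - (ln s + 1) * s + s\<^sup>2 / (2 * M)" and "b = ln s + 1 - s / M" and "c = 1 / (2 * M)"
    have "a + b * w y + c * (w y)\<^sup>2 \<le> ?e y" for y
    proof -
      have "a + b * w y + c * (w y)\<^sup>2 = s * ln s + (ln s + 1) * (w y - s) + (w y - s)\<^sup>2 / (2 * M)"
        using Mp by (simp add: a_def b_def c_def field_simps power2_eq_square)
      also have "\<dots> \<le> ?e y" using nn M up[of x] u0[of x] by (intro xlnx_tangent) (auto simp: s_def)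
      finally show ?thesis .
    qed
    moreover have "bounded_borel (\<lambda>y. a + b * w y + c * (w y)\<^sup>2)"
    proof -
      have "bounded_borel (\<lambda>y. (w y)\<^sup>2)" by (rule bounded_borel_square[OF w])
      then obtain A B where "\<And>y. \<bar>w y\<bar> \<le> A" "\<And>y. \<bar>(w y)\<^sup>2\<bar> \<le> B" using w by (auto simp: bounded_borel_def)
      then have "\<bar>a + b * w y + c * (w y)\<^sup>2\<bar> \<le> \<bar>a\<bar> + \<bar>b\<bar> * A + \<bar>c\<bar> * B" for y
        by (intro order_trans[OF abs_triangle_ineq] add_mono) (auto simp: abs_mult intro!: mult_left_mono)
      then show ?thesis using bounded_borelD[OF w] by (intro bounded_borelI) auto
    qed
    ultimately have "OU_op r (\<lambda>y. a + b * w y + c * (w y)\<^sup>2) x \<le> OU_op r ?e x"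
      by (intro OU_op_mono e r) auto
    moreover have "a + b * s + c * OU_op r ?sq x = s * ln s + (OU_op r ?sq x - s\<^sup>2) / (2 * M)"
      using Mp by (simp add: a_def b_def c_def field_simps power2_eq_square)
    ultimately show ?thesis by (simp add: OU_op_quadratic[OF w r] s_def)
  qed
  have sq: "bounded_borel ?sq" by (rule bounded_borel_square[OF w])
  note I = bounded_borel_integrable
  have i1: "integrable gauss_measure (\<lambda>x. ?u x * ln (?u x))" by (intro I bounded_borel_xlnx u u0)
  have i2: "integrable gauss_measure (OU_op r ?sq)" "integrable gauss_measure (\<lambda>x. (?u x)\<^sup>2)"
    by (intro I bounded_borel_OU_op sq r, intro I bounded_borel_square u)
  have "(\<integral>x. ?u x * ln (?u x) + (OU_op r ?sq x - (?u x)\<^sup>2) / (2 * M) \<partial>gauss_measure) \<le> (\<integral>x. OU_op r ?e x \<partial>gauss_measure)"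
    by (intro integral_mono pw I bounded_borel_OU_op e r Bochner_Integration.integrable_add
        i1 integrable_divide Bochner_Integration.integrable_diff i2)
  moreover have "(\<integral>x. ?u x * ln (?u x) + (OU_op r ?sq x - (?u x)\<^sup>2) / (2 * M) \<partial>gauss_measure)
     = entropy1 ?u + ((\<integral>x. (w x)\<^sup>2 \<partial>gauss_measure) - (\<integral>x. (?u x)\<^sup>2 \<partial>gauss_measure)) / (2 * M)"
    using i1 i2 by (simp add: entropy1_def integral_OU_op[OF sq r])
  ultimately show ?thesis by (simp add: integral_OU_op[OF e r] entropy1_def)
qed

text \<open>Unit mass makes the subtracted term integrate to 0. The new integrand is nonnegative and
  is compared pointwise with \<open>(w x - 1)\<^sup>2\<close> through \<open>aux_h1\<close>.\<close>

lemma entropy1_eq: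
  fixes w :: "real^'d \<Rightarrow> real"
  assumes w: "bounded_borel w" and nn: "\<And>x. 0 \<le> w x" and mass: "(\<integral>x. w x \<partial>gauss_measure) = 1"
  shows "entropy1 w = (\<integral>x. w x * ln (w x) - (w x - 1) \<partial>gauss_measure)"
proof -
  note i = bounded_borel_integrable[OF bounded_borel_xlnx[OF w nn]] bounded_borel_integrable[OF w]
  show ?thesis using i mass gauss.prob_space by (simp add: entropy1_def)
qed

lemma entropy1_nonneg:
  fixes w :: "real^'d \<Rightarrow> real"
  assumes "bounded_borel w" "\<And>x. 0 \<le> w x" "(\<integral>x. w x \<partial>gauss_measure) = 1"
  shows "0 \<le> entropy1 w"
  unfolding entropy1_eq[OF assms]
  by (intro Bochner_Integration.integral_nonneg) (use xlnx_ge assms in auto)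

lemma entropy1_le:
  fixes w :: "real^'d \<Rightarrow> real"
  assumes w: "bounded_borel w" "\<And>x. 0 \<le> w x" "(\<integral>x. w x \<partial>gauss_measure) = 1"
    and K: "AE x in gauss_measure. aux_h1 (w x) \<le> K"
  shows "entropy1 w \<le> K * (\<integral>x. (w x - 1)\<^sup>2 \<partial>gauss_measure)"
proof -
  note I = bounded_borel_integrable
  have "entropy1 w \<le> (\<integral>x. K * (w x - 1)\<^sup>2 \<partial>gauss_measure)"
    unfolding entropy1_eq[OF w]
  proof (rule integral_mono_AE)
    show "AE x in gauss_measure. w x * ln (w x) - (w x - 1) \<le> K * (w x - 1)\<^sup>2"
      using K by eventually_elim (simp only: aux_h1_eq[OF w(2)] mult_right_mono zero_le_power2)
  qed (intro I bounded_borel_xlnx w Bochner_Integration.integrable_diff integrable_mult_right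
      bounded_borel_square bounded_borel_minus_const bounded_borel_const)+
  then show ?thesis by simp
qed

lemma entropy_OU_iter:
  fixes w :: "real^'d \<Rightarrow> real"
  assumes w: "bounded_borel w" and nn: "\<And>x. 0 \<le> w x" and M: "\<And>x. w x \<le> M"
    and mass: "(\<integral>x. w x \<partial>gauss_measure) = 1" and r: "0 < r" "r < 1" and n: "n \<ge> 1"
    and orth: "\<And>k. (\<Sum>j\<in>UNIV. k j) < n \<Longrightarrow> (\<integral>x. (w x - 1) * multi_he k x \<partial>gauss_measure) = 0"
    and K: "0 < K" "AE x in gauss_measure. aux_h1 (w x) \<le> K" and M0: "M > 0"
  shows "entropy1 ((OU_op r ^^ m) w) \<le> entropy1 w * exp (- real m * (1 - r ^ (2 * n)) / (2 * (M * K)))"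
proof (induction m)
  case 0
  then show ?case by simp
next
  case (Suc m)
  note r2 = power2_less_one[OF r]
  define W where "W j = (OU_op r ^^ j) w" for j
  have WS: "W (Suc j) = OU_op r (W j)" for j by (simp add: W_def)
  have W: "bounded_borel (W j)" for j unfolding W_def by (rule bounded_borel_OU_iter[OF w r2])
  have W_range: "0 \<le> W j x \<and> W j x \<le> M" for j x
    by (induction j arbitrary: x) (auto simp: WS nn M W_def[of 0] intro!: OU_op_ge OU_op_le W r2)
  have W_mass: "(\<integral>x. W j x \<partial>gauss_measure) = 1" for j
    by (induction j) (auto simp: WS integral_OU_op[OF W r2] W_def[of 0] mass)
  have W_K: "AE x in gauss_measure. aux_h1 (W j x) \<le> K" for j
  proof (induction j)
    case (Suc j)
    then show ?case
      unfolding WS using W_range by (intro AE_I2) (rule OU_op_aux_h1_le[OF W _ r2], auto)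
  qed (use K in \<open>simp add: W_def\<close>)
  define F where "F j = (\<lambda>x. W j x - 1)" for j
  have F: "F j = (OU_op r ^^ j) (\<lambda>x. w x - 1)" for j
    by (induction j) (auto simp: F_def W_def[of 0] WS fun_eq_iff OU_op_diff_const[OF W r2, symmetric] dest!: ext[of "\<lambda>x. W _ x - 1"])
  \<comment> \<open>By unit mass the squared norms of \<open>W j\<close> and \<open>F j\<close>
    differ by exactly 1, so the loss of squared norm is the same for both.\<close>
  have W_F: "(\<integral>x. (W j x)\<^sup>2 \<partial>gauss_measure) = (\<integral>x. (F j x)\<^sup>2 \<partial>gauss_measure) + 1" for j
  proof -
    have "(\<integral>x. (F j x)\<^sup>2 \<partial>gauss_measure) = (\<integral>x. (W j x)\<^sup>2 - 2 * W j x + 1 \<partial>gauss_measure)"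
      by (simp add: F_def power2_diff) (simp add: algebra_simps)
    also have "\<dots> = (\<integral>x. (W j x)\<^sup>2 \<partial>gauss_measure) - 2 * 1 + 1"
      using bounded_borel_integrable[OF W[of j]] bounded_borel_integrable[OF bounded_borel_square[OF W[of j]]] gauss.prob_space
      by (simp add: W_mass)
    finally show ?thesis by simp
  qed
  define q where "q = r ^ (2 * n)"
  have q: "q < 1" unfolding q_def using r n by (intro power_less_one_iff[THEN iffD2]) auto
  define a where "a = (\<integral>x. (F m x)\<^sup>2 \<partial>gauss_measure)"
  have contr: "(\<integral>x. (F (Suc m) x)\<^sup>2 \<partial>gauss_measure) \<le> q * a"
    unfolding a_def q_def F by (intro OU_iter_contraction bounded_borel_minus_const w r n orth)
  have ent: "entropy1 (W m) \<le> K * a"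
    unfolding a_def F_def using W_range by (intro entropy1_le W W_mass W_K) auto
  have ent0: "0 \<le> entropy1 (W m)"
    using W_range by (intro entropy1_nonneg W W_mass) auto
  have "entropy1 (W (Suc m)) \<le> entropy1 (W m) - ((a + 1) - ((\<integral>x. (F (Suc m) x)\<^sup>2 \<partial>gauss_measure) + 1)) / (2 * M)"
    using entropy_OU_op[OF W[of m] _ _ _ r2, of M] W_range W_mass[of m] W_F[of m] W_F[of "Suc m"]
    by (simp add: a_def WS)
  also have "\<dots> \<le> entropy1 (W m) - ((1 - q) * a) / (2 * M)"
    using contr M0 by (intro diff_left_mono divide_right_mono) (auto simp: algebra_simps)
  \<comment> \<open>Here \<open>ent\<close> replaces the squared norm by the entropy, which closes
    the recursion in the entropy alone.\<close>
  also have "\<dots> \<le> entropy1 (W m) - ((1 - q) * (entropy1 (W m) / K)) / (2 * M)"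
    using ent K M0 q by (intro diff_left_mono divide_right_mono mult_left_mono) (auto simp: field_simps)
  also have "\<dots> = entropy1 (W m) * (1 + - (1 - q) / (2 * (M * K)))"
    using K M0 by (simp add: field_simps)
  also have "\<dots> \<le> entropy1 (W m) * exp (- (1 - q) / (2 * (M * K)))"
    by (intro mult_left_mono exp_ge_add_one_self ent0)
  also have "\<dots> \<le> (entropy1 w * exp (- real m * (1 - q) / (2 * (M * K)))) * exp (- (1 - q) / (2 * (M * K)))"
    using Suc by (intro mult_right_mono) (auto simp: W_def q_def)
  also have "\<dots> = entropy1 w * exp (- real (Suc m) * (1 - q) / (2 * (M * K)))"
    by (simp add: exp_add[symmetric] mult.assoc add_divide_distrib[symmetric] algebra_simps)
  finally show ?case by (simp add: W_def q_def)
qed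

lemma entropy_OU_decay:
  fixes w :: "real^'d \<Rightarrow> real"
  assumes w: "bounded_borel w" and nn: "\<And>x. 0 \<le> w x" and M: "\<And>x. w x \<le> M"
    and mass: "(\<integral>x. w x \<partial>gauss_measure) = 1" and t: "t > 0" and n: "n \<ge> 1"
    and orth: "\<And>k. (\<Sum>j\<in>UNIV. k j) < n \<Longrightarrow> (\<integral>x. (w x - 1) * multi_he k x \<partial>gauss_measure) = 0"
    and K: "0 < K" "AE x in gauss_measure. aux_h1 (w x) \<le> K" and M0: "M > 0"
  shows "entropy1 (OU_op (exp (- t)) w) \<le> entropy1 w * exp (- real n * t / (M * K))"
proof -
  \<comment> \<open>With \<open>m\<close> equal steps the total exponent is
    \<open>m * (1 - exp (- c / m))\<close>, which tends to \<open>c\<close>; its factor 2 cancels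
    the one in \<open>2 * (M * K)\<close>. The index \<open>Suc m\<close> avoids zero steps.\<close>
  define c where "c = 2 * real n * t"
  have "(\<lambda>m. real (Suc m) * (1 - exp (- c / real (Suc m)))) \<longlonglongrightarrow> c"
    by real_asymp
  then have "(\<lambda>m. entropy1 w * exp (- (real (Suc m) * (1 - exp (- c / real (Suc m)))) / (2 * (M * K))))
      \<longlonglongrightarrow> entropy1 w * exp (- c / (2 * (M * K)))"
    using M0 K by (intro tendsto_intros) auto
  moreover have "entropy1 (OU_op (exp (- t)) w)
      \<le> entropy1 w * exp (- (real (Suc m) * (1 - exp (- c / real (Suc m)))) / (2 * (M * K)))" for m
  proof -
    define r where "r = exp (- t / real (Suc m))"
    have r: "0 < r" "r < 1" using t by (auto simp: r_def divide_neg_pos)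
    have rm: "r ^ Suc m = exp (- t)"
      unfolding r_def exp_of_nat_mult[symmetric] by simp
    have rn: "r ^ (2 * n) = exp (- c / real (Suc m))"
      unfolding r_def exp_of_nat_mult[symmetric] by (simp add: c_def)
    show ?thesis
      using entropy_OU_iter[OF w nn M mass r n orth K M0, of "Suc m"]
      unfolding OU_iter[OF w r] rm rn by (simp only: minus_mult_left)
  qed
  ultimately have "entropy1 (OU_op (exp (- t)) w) \<le> entropy1 w * exp (- c / (2 * (M * K)))"
    by (intro LIMSEQ_le_const) auto
  then show ?thesis by (simp add: c_def)
qed

subsection \<open>The heat kernel representation\<close>

text \<open>With \<open>r = exp (- t)\<close> the heat time belonging to \<open>t\<close> is
  \<open>\<tau> = (1 - r\<^sup>2) / (2 * r\<^sup>2)\<close>. The Jacobian of the scaling and the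
  division by \<open>gauss_density x\<close> then turn the heat kernel into the Mehler kernel, so
  the two integrands agree pointwise.\<close>

lemma OU_solution_eq_OU_op:
  fixes w0 :: "real^'d \<Rightarrow> real"
  assumes sol: "OU_solution w0 w" and t: "t > 0" and [measurable]: "w0 \<in> borel_measurable borel"
  shows "w t = OU_op (exp (- t)) w0"
proof
  fix x :: "real^'d"
  define r where "r = exp (- t)"
  have r: "0 < r" "r < 1" using t by (auto simp: r_def)
  define p where "p = 1 - r\<^sup>2"
  have p: "p > 0" using r by (simp add: p_def power_less_one_iff)
  define E where "E = exp t"
  have E: "E > 0" "E = 1 / r" by (auto simp: E_def r_def exp_minus field_simps)
  define \<tau> where "\<tau> = (exp (2 * t) - 1) / 2"
  have e2: "exp (2 * t) - 1 = p / r\<^sup>2"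
    unfolding exp_double E_def[symmetric] E(2) using r by (simp add: p_def power_divide field_simps)
  have \<tau>: "\<tau> > 0" "\<tau> = p / (2 * r\<^sup>2)" using p r unfolding \<tau>_def e2 by auto
  let ?e = "- real CARD('d) / 2"
  have G: "gauss_density x > 0" by (rule gauss_density_pos)
  have "w t x = E ^ CARD('d) * heat_solution (\<lambda>y. w0 y * gauss_density y) \<tau> (E *\<^sub>R x) / gauss_density x"
    using sol t by (auto simp: OU_solution_iff \<tau>_def E_def)
  also have "\<dots> = (\<integral>y. E ^ CARD('d) / gauss_density x * (w0 y * gauss_density y * ((4 * pi * \<tau>) powr ?e
        * exp (- (norm (E *\<^sub>R x - y))\<^sup>2 / (4 * \<tau>)))) \<partial>lborel)"
    using \<tau>(1) by (simp add: heat_solution_def)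
  also have "\<dots> = (\<integral>y. gauss_density y * (w0 y * mehler r x y) \<partial>lborel)"
  proof (intro Bochner_Integration.integral_cong refl)
    fix y :: "real^'d"
    have 1: "E ^ CARD('d) * (4 * pi * \<tau>) powr ?e = (2 * pi) powr ?e * p powr ?e"
    proof -
      have "4 * pi * \<tau> = (2 * pi) * p * E\<^sup>2" using r by (simp add: \<tau>(2) E(2) power_divide)
      then have "(4 * pi * \<tau>) powr ?e = (2 * pi) powr ?e * p powr ?e * (E\<^sup>2) powr ?e"
        using p E(1) by (simp only: powr_mult)
      also have "(E\<^sup>2) powr ?e = 1 / E ^ CARD('d)"
      proof -
        have "E\<^sup>2 = E powr 2" using E(1) by simp
        then have "(E\<^sup>2) powr ?e = E powr (- real CARD('d))"
          by (simp only: powr_powr) simp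
        also have "\<dots> = 1 / E powr real CARD('d)" by (rule powr_minus_divide)
        also have "\<dots> = 1 / E ^ CARD('d)" by (simp only: powr_realpow[OF E(1)])
        finally show ?thesis .
      qed
      finally show ?thesis using E(1) by simp
    qed
    have 2: "- (norm (E *\<^sub>R x - y))\<^sup>2 / (4 * \<tau>) + (norm x)\<^sup>2 / 2
        = (2 * r * (x \<bullet> y) - r\<^sup>2 * ((norm x)\<^sup>2 + (norm y)\<^sup>2)) / (2 * p)"
    proof -
      have n: "(norm (E *\<^sub>R x - y))\<^sup>2 = (norm x)\<^sup>2 / r\<^sup>2 - 2 * (x \<bullet> y) / r + (norm y)\<^sup>2"
        unfolding power2_norm_eq_inner E(2)
        by (simp add: inner_diff_left inner_diff_right inner_commute[of y x] power2_eq_square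
            diff_divide_distrib)
      have q: "- A / (4 * \<tau>) = - (A * r\<^sup>2) / (2 * p)" for A using r p by (simp add: \<tau>(2) field_simps)
      have "- (norm (E *\<^sub>R x - y))\<^sup>2 / (4 * \<tau>) + (norm x)\<^sup>2 / 2
          = (- ((norm (E *\<^sub>R x - y))\<^sup>2 * r\<^sup>2) + (norm x)\<^sup>2 * p) / (2 * p)"
        unfolding q using p by (simp add: diff_divide_distrib)
      also have "- ((norm (E *\<^sub>R x - y))\<^sup>2 * r\<^sup>2) + (norm x)\<^sup>2 * p
          = 2 * r * (x \<bullet> y) - r\<^sup>2 * ((norm x)\<^sup>2 + (norm y)\<^sup>2)"
        unfolding n p_def using r by (simp add: field_simps power2_eq_square)
      finally show ?thesis .
    qed
    have 3: "1 / gauss_density x * (2 * pi) powr ?e = exp ((norm x)\<^sup>2 / 2)"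
      by (simp add: gauss_density_def exp_minus field_simps)
    have "E ^ CARD('d) / gauss_density x * (w0 y * gauss_density y * ((4 * pi * \<tau>) powr ?e
        * exp (- (norm (E *\<^sub>R x - y))\<^sup>2 / (4 * \<tau>))))
      = gauss_density y * w0 y * (1 / gauss_density x * (E ^ CARD('d) * (4 * pi * \<tau>) powr ?e)
        * exp (- (norm (E *\<^sub>R x - y))\<^sup>2 / (4 * \<tau>)))"
      by simp
    also have "\<dots> = gauss_density y * w0 y * ((1 / gauss_density x * (2 * pi) powr ?e) * p powr ?e
        * exp (- (norm (E *\<^sub>R x - y))\<^sup>2 / (4 * \<tau>)))"
      unfolding 1 by (simp only: mult_ac)
    also have "\<dots> = gauss_density y * w0 y * (p powr ?e * exp (- (norm (E *\<^sub>R x - y))\<^sup>2 / (4 * \<tau>) + (norm x)\<^sup>2 / 2))"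
      unfolding 3 by (simp only: exp_add mult_ac)
    also have "\<dots> = gauss_density y * (w0 y * mehler r x y)"
      unfolding 2 by (simp add: mehler_def p_def)
    finally show "E ^ CARD('d) / gauss_density x * (w0 y * gauss_density y * ((4 * pi * \<tau>) powr ?e
        * exp (- (norm (E *\<^sub>R x - y))\<^sup>2 / (4 * \<tau>)))) = gauss_density y * (w0 y * mehler r x y)" .
  qed
  also have "\<dots> = OU_op r w0 x"
    unfolding OU_op_def by (subst integral_gauss_measure) measurable
  finally show "w t x = OU_op (exp (- t)) w0 x" by (simp add: r_def)
qed

text \<open>Since \<open>real_of_ereal\<close> sends both infinities to 0, the essential supremum
  must first be shown finite: nonnegativity excludes the negative infinity and \<open>C\<close> the
  positive one.\<close>

lemma AE_le_real_esssup:
  fixes f :: "real^'d \<Rightarrow> real"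
  assumes [measurable]: "f \<in> borel_measurable borel"
    and nn: "AE x in lborel. 0 \<le> f x" and C: "AE x in lborel. f x \<le> C"
  shows "AE x in lborel. f x \<le> real_of_ereal (esssup lborel (\<lambda>x. ereal (f x)))"
proof -
  let ?e = "esssup lborel (\<lambda>x. ereal (f x))"
  have le: "AE x in lborel. ereal (f x) \<le> ?e" by (rule esssup_AE)
  have "AE x in (lborel :: (real^'d) measure). 0 \<le> ?e"
    using le nn by eventually_elim (metis ereal_less_eq(5) order_trans)
  then have e0: "0 \<le> ?e"
    \<comment> \<open>A statement independent of \<open>x\<close> that holds almost everywhere is
      true because Lebesgue measure is not zero.\<close>
    using eventually_happens[of "\<lambda>_. 0 \<le> ?e" "ae_filter (lborel :: (real^'d) measure)"]
    by (auto simp: ae_filter_eq_bot_iff)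
  have "?e \<le> ereal C" using C by (intro esssup_I) auto
  with e0 have "\<bar>?e\<bar> \<noteq> \<infinity>" by auto
  then have "ereal (real_of_ereal ?e) = ?e" by (rule ereal_real')
  with le show ?thesis by (metis (no_types, lifting) ereal_less_eq(3) eventually_mono)
qed

section \<open>Reduction to a bounded representative and conclusion\<close>

theorem corollary3:
  fixes w0 :: "real ^ 'd \<Rightarrow> real"
    and w :: "real \<Rightarrow> real ^ 'd \<Rightarrow> real"
    and n :: nat
  assumes n_ge_1: "n \<ge> 1"
    and w0_integrable: "integrable gauss_measure w0"
    and w0_nonneg: "AE x in lborel. 0 \<le> w0 x"
    and w0_bounded: "\<exists>C. AE x in lborel. \<bar>w0 x\<bar> \<le> C"
    and w0_mass: "(\<integral>x. w0 x \<partial>gauss_measure) = 1"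
    and w0_orth: "\<forall>k :: 'd \<Rightarrow> nat. 0 < (\<Sum>j\<in>UNIV. k j) \<and> (\<Sum>j\<in>UNIV. k j) < n \<longrightarrow>
           (\<integral>x. w0 x * multi_hermite k x \<partial>gauss_measure) = 0"
    and w_solution: "OU_solution w0 w"
  shows "\<forall>t\<ge>0. entropy1 (w t) \<le> entropy1 w0 * exp (- real n * t / cal_H1 w0)"
proof (intro allI impI)
  fix t :: real assume t: "0 \<le> t"
  show "entropy1 (w t) \<le> entropy1 w0 * exp (- real n * t / cal_H1 w0)"
  proof (cases "t = 0")
    case True
    then show ?thesis using OU_solution_initial[OF w_solution] by simp
  next
    case False
    then have t: "t > 0" using t by simp
    have [measurable]: "w0 \<in> borel_measurable borel"
      using borel_measurable_integrable[OF w0_integrable]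
      by (simp add: measurable_cong_sets[OF sets_gauss_measure refl])
    define M where "M = Linf_norm w0"
    define K where "K = real_of_ereal (esssup lborel (\<lambda>x. ereal (aux_h1 (w0 x))))"
    have M_AE: "AE x in lborel. \<bar>w0 x\<bar> \<le> M"
    proof -
      obtain C where "AE x in lborel. \<bar>w0 x\<bar> \<le> C" using w0_bounded by blast
      then show ?thesis unfolding M_def Linf_norm_def by (intro AE_le_real_esssup) auto
    qed
    have K_AE: "AE x in lborel. aux_h1 (w0 x) \<le> K"
      unfolding K_def using w0_nonneg
      by (intro AE_le_real_esssup[where C = 1])
        (auto elim!: eventually_mono intro: aux_h1_le_1 aux_h1_pos[THEN less_imp_le])
    \<comment> \<open>A probability average of \<open>w0\<close> cannot exceed its essential
      supremum, so unit mass gives the lower bound.\<close>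
    have M: "M \<ge> 1"
    proof -
      have "(\<integral>x. w0 x \<partial>gauss_measure) \<le> (\<integral>x. M \<partial>(gauss_measure :: (real^'d) measure))"
        by (rule integral_mono_AE[OF w0_integrable]) (use M_AE in \<open>auto simp: AE_gauss_measure elim: eventually_mono\<close>)
      then show ?thesis
        using w0_mass prob_space.prob_space[OF prob_space_gauss_measure[where 'd = 'd]] by simp
    qed
    \<comment> \<open>Truncation changes \<open>w0\<close> only on a null set, hence no integral,
      and makes the bounds hold at every point as the results on \<open>bounded_borel\<close>
      require.\<close>
    define u where "u x = max 0 (min M (w0 x))" for x
    have u_eq: "AE x in gauss_measure. w0 x = u x"
      unfolding AE_gauss_measure using M_AE w0_nonneg by eventually_elim (auto simp: u_def)
    have [measurable]: "u \<in> borel_measurable borel" unfolding u_def by measurable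
    have u_range: "0 \<le> u x" "u x \<le> M" for x using M by (auto simp: u_def)
    have u: "bounded_borel u" by (rule bounded_borelI[of _ M]) (use u_range in \<open>auto simp: abs_le_iff\<close>)
    have int_eq: "(\<integral>x. F x (w0 x) \<partial>gauss_measure) = (\<integral>x. F x (u x) \<partial>gauss_measure)"
      if "(\<lambda>x. F x (w0 x)) \<in> borel_measurable borel" "(\<lambda>x. F x (u x)) \<in> borel_measurable borel" for F :: "real^'d \<Rightarrow> real \<Rightarrow> real"
      by (rule integral_cong_AE)
        (use that u_eq in \<open>auto simp: measurable_cong_sets[OF sets_gauss_measure refl] elim: eventually_mono\<close>)
    have mh: "multi_he k \<in> borel_measurable borel" for k :: "'d \<Rightarrow> nat"
      by (rule hpoly_measurable[OF hpoly.base[OF order_refl]])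
    have u_mass: "(\<integral>x. u x \<partial>gauss_measure) = 1"
      using int_eq[of "\<lambda>_ z. z"] w0_mass by simp
    have ent: "entropy1 w0 = entropy1 u"
      unfolding entropy1_def by (rule int_eq) measurable
    have OU: "OU_op r w0 = OU_op r u" for r
      unfolding OU_op_def by (rule ext, rule int_eq) measurable
    have uK: "AE x in gauss_measure. aux_h1 (u x) \<le> K"
      using K_AE[folded AE_gauss_measure] u_eq by eventually_elim simp
    have K: "K > 0"
    proof -
      have "AE x in (gauss_measure :: (real^'d) measure). 0 < K"
        using uK by eventually_elim (use aux_h1_pos u_range in \<open>meson less_le_trans\<close>)
      then show ?thesis by simp
    qed
    \<comment> \<open>Degree zero is the mass condition, which is why 1 is subtracted. In positive
      degree the constant 1 is itself orthogonal to \<open>multi_he k\<close>, so the hypothesis on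
      \<open>w0\<close> carries over.\<close>
    have orth: "(\<integral>x. (u x - 1) * multi_he k x \<partial>gauss_measure) = 0" if k: "(\<Sum>j\<in>UNIV. k j) < n" for k
    proof (cases "\<forall>j. k j = 0")
      case True
      then have "multi_he k x = 1" for x by (simp add: multi_he_def)
      then show ?thesis
        using bounded_borel_integrable[OF u] u_mass gauss.prob_space by simp
    next
      case False
      then obtain i where i: "k i > 0" by auto
      note [measurable] = mh[of k]
      have "0 < (\<Sum>j\<in>UNIV. k j)" using i by (simp add: sum_pos2[of UNIV i])
      then have "(\<integral>x. w0 x * multi_hermite k x \<partial>gauss_measure) = 0" using w0_orth k by blast
      then have "(\<integral>x. w0 x * multi_he k x \<partial>gauss_measure) = 0"
        by (simp add: multi_hermite_eq prod_zero_iff)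
      then have "(\<integral>x. u x * multi_he k x \<partial>gauss_measure) = 0"
        using int_eq[of "\<lambda>x z. z * multi_he k x"] by simp
      moreover have hp: "hpoly (\<Sum>j\<in>UNIV. k j) (multi_he k)" by (rule hpoly.base) simp
      have "integrable gauss_measure (\<lambda>x. u x * multi_he k x)"
        by (rule integrable_bounded_hpoly[OF _ _ hp, of _ M]) (use u_range in \<open>auto simp: abs_le_iff\<close>)
      moreover have "integrable gauss_measure (\<lambda>x. 1 * multi_he k x)"
        by (rule integrable_bounded_hpoly[OF _ _ hp, of _ 1]) auto
      ultimately show ?thesis
        by (simp add: left_diff_distrib integral_multi_he[of k i, OF i])
    qed
    have "entropy1 (OU_op (exp (- t)) u) \<le> entropy1 u * exp (- real n * t / (M * K))"
      using M by (intro entropy_OU_decay u u_range u_mass t n_ge_1 orth K uK) auto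
    moreover have "cal_H1 w0 = M * K" by (simp add: cal_H1_def M_def K_def)
    moreover have "w t = OU_op (exp (- t)) u"
      using OU_solution_eq_OU_op[OF w_solution t] by (simp add: OU)
    ultimately show ?thesis by (simp add: ent)
  qed
qed

end
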